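(* Let $G$ be a second countable locally compact group with left Haar measure $m$, let $Z$ be a standard Borel space, and let $f:G\to Z$ and $g:G\to Z$ be Borel functions. Then $E=\{(s,t): f(s)=g(t)\}\subset G\times G$ is a strong $m$-Ditkin set.
   Context: A subset of $G\times G$ is marginally null if it is contained in $(M\times G)\cup(G\times N)$ with $m(M)=m(N)=0$. Two sets are marginally equivalent if their symmetric difference is marginally null, and a property holds m.a.e. (marginally almost everywhere) if it holds off a marginally null set. A set is pseudo-open if it is marginally equivalent to a countable union of measurable rectangles $A\times B$; complements of pseudo-open sets are pseudo-closed; a pseudo-neighbourhood of $F$ is a pseudo-open set containing $F$ up to a marginally null set. $T(G)=L^2(G)\hat\otimes L^2(G)$ (projective tensor product, with norm $\|\cdot\|_{T(G)}$), whose elements are identified with functions $\Psi(x,y)=\sum_n f_n(x)g_n(y)$, $f_n,g_n\in L^2(G)$, $\sum_n\|f_n\|_2\|g_n\|_2<\infty$, defined m.a.e. (functions equal m.a.e. being identified). For pseudo-closed $F\subset G\times G$, $\Phi(F)=\{w\in T(G): w=0\text{ m.a.e. on }F\}$. $V^\infty(G)$ is the space of (marginal equivalence classes of) functions $\Psi(x,y)=\sum_{n=1}^\infty f_n(x)g_n(y)$ with $f_n,g_n\in L^\infty(G)$ and $\sum_n|f_n(x)|^2\le C$, $\sum_n|g_n(y)|^2\le C$ for some constant $C$ and (almost) all $x,y\in G$. Elements of $V^\infty(G)$ act on $T(G)$ by pointwise multiplication. A pseudo-closed set $F\subset G\times G$ is an $m$-Ditkin set if for every $w\in\Phi(F)$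 there is a sequence $\tau_n\in V^\infty(G)$ such that each $\tau_n$ vanishes on a pseudo-neighbourhood of $F$ and $\|\tau_nw-w\|_{T(G)}\to0$. It is a strong $m$-Ditkin set if one such sequence $\{\tau_n\}$ can be chosen that works for all $w\in\Phi(F)$ simultaneously. *)

theory Defs
  imports "HOL-Analysis.Analysis"
begin

text \<open>
  Groups are elements of the library class \<open>topological_group_add\<close>. That class is written
  additively but does not assume commutativity, so \<open>a + x\<close> is the group product.
\<close>

definition left_haar_measure :: "'a::topological_group_add measure \<Rightarrow> bool" where
  "left_haar_measure m \<longleftrightarrow>
     sets m = sets borel \<and>
     (\<exists>A\<in>sets m. emeasure m A \<noteq> 0) \<and>
     (\<forall>K. compact K \<longrightarrow> emeasure m K < \<infinity>) \<and>
     (\<forall>A\<in>sets m. emeasure m A = (INF U\<in>{U. open U \<and> A \<subseteq> U}. emeasure m U)) \<and>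
     (\<forall>U. open U \<longrightarrow>
        emeasure m U = (SUP K\<in>{K. compact K \<and> K \<subseteq> U}. emeasure m K)) \<and>
     (\<forall>a. \<forall>A\<in>sets m. emeasure m ((\<lambda>x. a + x) ` A) = emeasure m A)"

text \<open>
  A standard Borel space is a measurable space whose \<open>\<sigma>\<close>-algebra is generated by the open
  sets of a Polish topology on it. The measure carried by \<open>Z\<close> plays no role.
\<close>

definition standard_borel_space :: "'z measure \<Rightarrow> bool" where
  "standard_borel_space Z \<longleftrightarrow>
     (\<exists>X. completely_metrizable_space X \<and> second_countable X \<and>
          space Z = topspace X \<and> sets Z = sigma_sets (topspace X) {U. openin X U})"


definition marginally_null :: "'a measure \<Rightarrow> ('a \<times> 'a) set \<Rightarrow> bool" where
  "marginally_null m S \<longleftrightarrow>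
     (\<exists>M\<in>null_sets m. \<exists>N\<in>null_sets m. S \<subseteq> (M \<times> space m) \<union> (space m \<times> N))"

definition marginally_equivalent ::
    "'a measure \<Rightarrow> ('a \<times> 'a) set \<Rightarrow> ('a \<times> 'a) set \<Rightarrow> bool" where
  "marginally_equivalent m S S' \<longleftrightarrow> marginally_null m ((S - S') \<union> (S' - S))"

definition mae :: "'a measure \<Rightarrow> ('a \<times> 'a \<Rightarrow> bool) \<Rightarrow> bool" where
  "mae m P \<longleftrightarrow> marginally_null m {p \<in> space m \<times> space m. \<not> P p}"

definition pseudo_open :: "'a measure \<Rightarrow> ('a \<times> 'a) set \<Rightarrow> bool" where
  "pseudo_open m S \<longleftrightarrow> S \<subseteq> space m \<times> space m \<and>
     (\<exists>A B :: nat \<Rightarrow> 'a set. (\<forall>n. A n \<in> sets m \<and> B n \<in> sets m) \<and>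
        marginally_equivalent m S (\<Union>n. A n \<times> B n))"

definition pseudo_closed :: "'a measure \<Rightarrow> ('a \<times> 'a) set \<Rightarrow> bool" where
  "pseudo_closed m S \<longleftrightarrow> S \<subseteq> space m \<times> space m \<and> pseudo_open m (space m \<times> space m - S)"

definition pseudo_neighbourhood ::
    "'a measure \<Rightarrow> ('a \<times> 'a) set \<Rightarrow> ('a \<times> 'a) set \<Rightarrow> bool" where
  "pseudo_neighbourhood m U F \<longleftrightarrow> pseudo_open m U \<and> marginally_null m (F - U)"


definition in_L2 :: "'a measure \<Rightarrow> ('a \<Rightarrow> complex) \<Rightarrow> bool" where
  "in_L2 m f \<longleftrightarrow> f \<in> borel_measurable m \<and> integrable m (\<lambda>x. (cmod (f x))\<^sup>2)"

definition L2_nrm :: "'a measure \<Rightarrow> ('a \<Rightarrow> complex) \<Rightarrow> real" where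
  "L2_nrm m f = sqrt (\<integral>x. (cmod (f x))\<^sup>2 \<partial>m)"

definition in_Linfty :: "'a measure \<Rightarrow> ('a \<Rightarrow> complex) \<Rightarrow> bool" where
  "in_Linfty m f \<longleftrightarrow> f \<in> borel_measurable m \<and> (\<exists>B. AE x in m. cmod (f x) \<le> B)"

text \<open>
  Elements of \<open>T(G)\<close> and \<open>V\<^sup>\<infinity>(G)\<close> are represented by functions on \<open>G \<times> G\<close>, two functions
  being representatives of the same element when they are equal m.a.e.; all notions
  below are invariant under this identification.

  Each \<open>\<Sum>\<^sub>n f\<^sub>n \<otimes> g\<^sub>n\<close> with \<open>\<Sum>\<^sub>n \<parallel>f\<^sub>n\<parallel>\<^sub>2 \<parallel>g\<^sub>n\<parallel>\<^sub>2 < \<infinity>\<close> in the projective tensor product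
  is identified with its m.a.e. pointwise sum.
\<close>

definition T_representation ::
    "'a measure \<Rightarrow> ('a \<times> 'a \<Rightarrow> complex) \<Rightarrow> (nat \<Rightarrow> 'a \<Rightarrow> complex) \<Rightarrow> (nat \<Rightarrow> 'a \<Rightarrow> complex) \<Rightarrow> bool"
  where
  "T_representation m w f g \<longleftrightarrow>
     (\<forall>n. in_L2 m (f n) \<and> in_L2 m (g n)) \<and>
     summable (\<lambda>n. L2_nrm m (f n) * L2_nrm m (g n)) \<and>
     mae m (\<lambda>(x, y). (\<lambda>n. f n x * g n y) sums w (x, y))"

definition T_space :: "'a measure \<Rightarrow> ('a \<times> 'a \<Rightarrow> complex) set" where
  "T_space m = {w. \<exists>f g. T_representation m w f g}"

text \<open>
  The projective norm: the infimum of \<open>\<Sum>\<^sub>n \<parallel>f\<^sub>n\<parallel>\<^sub>2 \<parallel>g\<^sub>n\<parallel>\<^sub>2\<close> over all representations. It is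
  \<open>\<infinity>\<close> exactly for functions that do not represent an element of \<open>T(G)\<close>.
\<close>

definition T_norm :: "'a measure \<Rightarrow> ('a \<times> 'a \<Rightarrow> complex) \<Rightarrow> ennreal" where
  "T_norm m w =
     Inf {ennreal (\<Sum>n. L2_nrm m (f n) * L2_nrm m (g n)) | f g. T_representation m w f g}"

definition V_infty :: "'a measure \<Rightarrow> ('a \<times> 'a \<Rightarrow> complex) set" where
  "V_infty m = {w. \<exists>(f :: nat \<Rightarrow> 'a \<Rightarrow> complex) g C.
     (\<forall>n. in_Linfty m (f n) \<and> in_Linfty m (g n)) \<and>
     (AE x in m. summable (\<lambda>n. (cmod (f n x))\<^sup>2) \<and> (\<Sum>n. (cmod (f n x))\<^sup>2) \<le> C) \<and>
     (AE y in m. summable (\<lambda>n. (cmod (g n y))\<^sup>2) \<and> (\<Sum>n. (cmod (g n y))\<^sup>2) \<le> C) \<and>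
     mae m (\<lambda>(x, y). (\<lambda>n. f n x * g n y) sums w (x, y))}"

definition Phi_space :: "'a measure \<Rightarrow> ('a \<times> 'a) set \<Rightarrow> ('a \<times> 'a \<Rightarrow> complex) set" where
  "Phi_space m F = {w \<in> T_space m. mae m (\<lambda>p. p \<in> F \<longrightarrow> w p = 0)}"

definition vanishes_near :: "'a measure \<Rightarrow> ('a \<times> 'a) set \<Rightarrow> ('a \<times> 'a \<Rightarrow> complex) \<Rightarrow> bool" where
  "vanishes_near m F \<tau> \<longleftrightarrow>
     (\<exists>U. pseudo_neighbourhood m U F \<and> mae m (\<lambda>p. p \<in> U \<longrightarrow> \<tau> p = 0))"

definition strong_m_Ditkin :: "'a measure \<Rightarrow> ('a \<times> 'a) set \<Rightarrow> bool" where
  "strong_m_Ditkin m F \<longleftrightarrow> pseudo_closed m F \<and>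
     (\<exists>\<tau> :: nat \<Rightarrow> 'a \<times> 'a \<Rightarrow> complex.
        (\<forall>n. \<tau> n \<in> V_infty m \<and> vanishes_near m F (\<tau> n)) \<and>
        (\<forall>w\<in>Phi_space m F. (\<lambda>n. T_norm m (\<lambda>p. \<tau> n p * w p - w p)) \<longlonglongrightarrow> 0))"

end

theory Submission
  imports Defs
begin

text \<open>
  A countable family of Borel sets separating the points of \<open>Z\<close> pulls back along \<open>f\<close> and \<open>g\<close> to Borel
  sets \<open>F i\<close> and \<open>G i\<close> of the group, and \<open>f s = g t\<close> means that \<open>s \<in> F i \<longleftrightarrow> t \<in> G i\<close> for all \<open>i\<close>. The
  first \<open>k\<close> of these sets divide the group into finitely many cells, once through the \<open>F i\<close> and once
  through the \<open>G i\<close>. Let \<open>U\<^sub>k\<close> be the finite union of the products of corresponding cells. It contains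
  \<open>E\<close>, and the \<open>U\<^sub>k\<close> decrease to \<open>E\<close>, so \<open>E\<close> is pseudo-closed. The functions \<open>\<tau>\<^sub>k = 1 - \<chi>(U\<^sub>k)\<close> lie in
  \<open>V\<^sup>\<infinity>\<close>, vanish on \<open>U\<^sub>k\<close> and do not depend on \<open>w\<close>. As \<open>\<tau>\<^sub>k w - w = - \<chi>(U\<^sub>k) w\<close>, everything comes
  down to \<open>\<parallel>\<chi>(U\<^sub>k) w\<parallel> \<longlonglongrightarrow> 0\<close> for \<open>w\<close> vanishing on \<open>E\<close> (\<open>T_norm_cells_tendsto_0\<close>).

  This is not a matter of the rectangles getting small: for \<open>f = g = id\<close> and \<open>w = a \<otimes> a\<close> with a real
  function \<open>a\<close>, each \<open>\<chi>(U\<^sub>k) w\<close> has the norm of \<open>w\<close>. The vanishing on \<open>E\<close> has to be used, and it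
  concerns a set that is usually null for the product measure. Write \<open>w = \<Sum>\<^sub>n a\<^sub>n \<otimes> b\<^sub>n\<close> with
  \<open>\<Sum>\<^sub>n |a\<^sub>n|\<^sup>2\<close> and \<open>\<Sum>\<^sub>n |b\<^sub>n|\<^sup>2\<close> integrable (\<open>Phi_space_square_summable\<close>), so that \<open>w(x,y)\<close> is the
  pairing of two square-summable sequences. By Lusin's theorem (\<open>lusin_functions\<close>) there are compact
  sets \<open>K\<close> and \<open>L\<close>, carrying all but a small part of the two integrals, on which these sequences
  depend continuously on the point and all \<open>F i\<close>, respectively \<open>G i\<close>, are relatively clopen.

  Fix \<open>x \<in> K\<close>. The points of \<open>K\<close> that no \<open>F i\<close> separates from \<open>x\<close> form a compact set, so finitely
  many of them, \<open>p\<^sub>1, ..., p\<^sub>r\<close>, approximate all the others in \<open>l\<^sup>2\<close>. At every \<open>y \<in> L\<close> in the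
  corresponding limit cell all \<open>w(p\<^sub>i, y)\<close> are zero. By compactness both facts persist approximately
  on the cells of a finite level, with the values \<open>w(p\<^sub>i, y)\<close> as small as desired compared with \<open>r\<close>,
  and the level can be chosen uniformly in \<open>x\<close> (\<open>negligible_cells\<close>). On such a product of cells,
  replacing the sequence at a point by that at the nearest \<open>p\<^sub>i\<close> changes \<open>w\<close> little in norm, and what
  is left is a sum of \<open>r\<close> elementary tensors of very small norm
  (\<open>T_norm_negligible_rectangle\<close>). The resulting bounds are additive over the cells
  (\<open>T_norm_cells_le\<close>), which keeps the number of cells out of the final estimate.
\<close>

section \<open>The projective norm\<close>

lemma marginally_null_mono:
  "marginally_null m T \<Longrightarrow> S \<subseteq> T \<Longrightarrow> marginally_null m S"
  unfolding marginally_null_def by blast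

lemma marginally_null_empty [simp]: "marginally_null m {}"
  unfolding marginally_null_def by blast

lemma marginally_null_Un:
  assumes "marginally_null m S" "marginally_null m T"
  shows "marginally_null m (S \<union> T)"
proof -
  obtain M N where 1: "M \<in> null_sets m" "N \<in> null_sets m"
      "S \<subseteq> (M \<times> space m) \<union> (space m \<times> N)"
    using assms(1) unfolding marginally_null_def by blast
  obtain M' N' where 2: "M' \<in> null_sets m" "N' \<in> null_sets m"
      "T \<subseteq> (M' \<times> space m) \<union> (space m \<times> N')"
    using assms(2) unfolding marginally_null_def by blast
  show ?thesis
    unfolding marginally_null_def
    by (rule bexI[of _ "M \<union> M'"], rule bexI[of _ "N \<union> N'"]) (use 1 2 in auto)
qed

lemma mae_everywhere: "(\<And>x y. P (x, y)) \<Longrightarrow> mae m P"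
  unfolding mae_def by (rule marginally_null_mono[OF marginally_null_empty]) auto

lemma maeE:
  assumes "mae m P"
  obtains M N where "M \<in> null_sets m" "N \<in> null_sets m"
    "\<And>x y. x \<in> space m - M \<Longrightarrow> y \<in> space m - N \<Longrightarrow> P (x, y)"
proof -
  obtain M N where MN: "M \<in> null_sets m" "N \<in> null_sets m"
      "{p \<in> space m \<times> space m. \<not> P p} \<subseteq> (M \<times> space m) \<union> (space m \<times> N)"
    using assms unfolding mae_def marginally_null_def by blast
  show ?thesis
  proof (rule that[OF MN(1,2)])
    fix x y assume "x \<in> space m - M" "y \<in> space m - N"
    then show "P (x, y)" using subsetD[OF MN(3), of "(x, y)"] by auto
  qed
qed

lemma mae_mp2:
  assumes "mae m P" "mae m Q" "\<And>x y. P (x, y) \<Longrightarrow> Q (x, y) \<Longrightarrow> R (x, y)"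
  shows "mae m R"
  unfolding mae_def
  by (rule marginally_null_mono[OF marginally_null_Un[OF assms(1,2)[unfolded mae_def]]])
     (use assms(3) in auto)

lemma mae_mono:
  assumes "mae m P" "\<And>x y. P (x, y) \<Longrightarrow> R (x, y)"
  shows "mae m R"
  using mae_mp2[OF assms(1,1)] assms(2) by blast

lemma sums_interleave:
  fixes f g :: "nat \<Rightarrow> complex"
  assumes "f sums a" "g sums b"
  shows "(\<lambda>n. if even n then f (n div 2) else g ((n - 1) div 2)) sums (a + b)"
proof -
  have "(\<lambda>n. if even n then Re (f (n div 2)) else Re (g ((n - 1) div 2))) sums (Re b + Re a)"
    "(\<lambda>n. if even n then Im (f (n div 2)) else Im (g ((n - 1) div 2))) sums (Im b + Im a)"
    using assms by (auto intro!: sums_if simp: sums_complex_iff)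
  then show ?thesis
    by (simp add: sums_complex_iff if_distrib add.commute)
qed

lemma T_norm_le:
  assumes "T_representation m u a b"
  shows "T_norm m u \<le> ennreal (\<Sum>n. L2_nrm m (a n) * L2_nrm m (b n))"
  unfolding T_norm_def by (rule Inf_lower) (use assms in blast)

text \<open>
  Off a marginally null set both expansions converge and may be interleaved, so a representation of each
  summand gives one of the sum with the two costs added.
\<close>

lemma T_norm_add: "T_norm m (\<lambda>p. u p + v p) \<le> T_norm m u + T_norm m v"
proof -
  have pair: "T_norm m (\<lambda>p. u p + v p) \<le> s + s'"
    if s: "s \<in> {ennreal (\<Sum>n. L2_nrm m (a n) * L2_nrm m (b n)) | a b. T_representation m u a b}"
      and s': "s' \<in> {ennreal (\<Sum>n. L2_nrm m (a n) * L2_nrm m (b n)) | a b. T_representation m v a b}"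
    for s s'
  proof -
    from s obtain a b where ab: "T_representation m u a b"
      and s_eq: "s = ennreal (\<Sum>n. L2_nrm m (a n) * L2_nrm m (b n))" by blast
    from s' obtain a' b' where ab': "T_representation m v a' b'"
      and s'_eq: "s' = ennreal (\<Sum>n. L2_nrm m (a' n) * L2_nrm m (b' n))" by blast
    define c where "c n = (if even n then a (n div 2) else a' ((n - 1) div 2))" for n
    define d where "d n = (if even n then b (n div 2) else b' ((n - 1) div 2))" for n
    have nonneg: "0 \<le> L2_nrm m h" for h
      by (simp add: L2_nrm_def)
    have sums: "(\<lambda>n. L2_nrm m (c n) * L2_nrm m (d n)) sums
        ((\<Sum>n. L2_nrm m (a' n) * L2_nrm m (b' n)) + (\<Sum>n. L2_nrm m (a n) * L2_nrm m (b n)))"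
    proof -
      have "(\<lambda>n. L2_nrm m (a n) * L2_nrm m (b n)) sums (\<Sum>n. L2_nrm m (a n) * L2_nrm m (b n))"
        "(\<lambda>n. L2_nrm m (a' n) * L2_nrm m (b' n)) sums (\<Sum>n. L2_nrm m (a' n) * L2_nrm m (b' n))"
        using ab ab' by (auto simp: T_representation_def summable_sums)
      from sums_if[OF this(2,1)] show ?thesis
        by (simp add: c_def d_def if_distrib[of "L2_nrm m"] cong: if_cong)
           (smt (verit, best) sums_cong)
    qed
    have "T_representation m (\<lambda>p. u p + v p) c d"
      unfolding T_representation_def
    proof (intro conjI allI)
      show "in_L2 m (c n)" "in_L2 m (d n)" for n
        using ab ab' by (auto simp: c_def d_def T_representation_def)
      show "summable (\<lambda>n. L2_nrm m (c n) * L2_nrm m (d n))"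
        using sums by (rule sums_summable)
      show "mae m (\<lambda>(x, y). (\<lambda>n. c n x * d n y) sums (u (x, y) + v (x, y)))"
      proof (rule mae_mp2)
        show "mae m (\<lambda>(x, y). (\<lambda>n. a n x * b n y) sums u (x, y))"
          "mae m (\<lambda>(x, y). (\<lambda>n. a' n x * b' n y) sums v (x, y))"
          using ab ab' by (auto simp: T_representation_def)
        fix x y
        assume "case (x, y) of (x, y) \<Rightarrow> (\<lambda>n. a n x * b n y) sums u (x, y)"
          "case (x, y) of (x, y) \<Rightarrow> (\<lambda>n. a' n x * b' n y) sums v (x, y)"
        then have "(\<lambda>n. if even n then a (n div 2) x * b (n div 2) y
            else a' ((n - 1) div 2) x * b' ((n - 1) div 2) y) sums (u (x, y) + v (x, y))"
          by (intro sums_interleave) auto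
        also have "(\<lambda>n. if even n then a (n div 2) x * b (n div 2) y
            else a' ((n - 1) div 2) x * b' ((n - 1) div 2) y) = (\<lambda>n. c n x * d n y)"
          by (auto simp: c_def d_def)
        finally show "case (x, y) of (x, y) \<Rightarrow> (\<lambda>n. c n x * d n y) sums (u (x, y) + v (x, y))"
          by simp
      qed
    qed
    from T_norm_le[OF this] show ?thesis
      using sums ab ab' nonneg unfolding s_eq s'_eq
      by (subst (asm) sums_unique[symmetric, OF sums])
         (simp add: T_representation_def suminf_nonneg add.commute)
  qed
  let ?A = "{ennreal (\<Sum>n. L2_nrm m (a n) * L2_nrm m (b n)) | a b. T_representation m u a b}"
  let ?B = "{ennreal (\<Sum>n. L2_nrm m (a n) * L2_nrm m (b n)) | a b. T_representation m v a b}"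
  have less_add: "x < x + ennreal e" if "x < top" "0 < e" for x :: ennreal and e
    using that by (cases x) (auto simp: ennreal_less_iff simp flip: ennreal_plus)
  show ?thesis
  proof (rule ennreal_le_epsilon)
    fix e :: real assume fin: "T_norm m u + T_norm m v < top" and "0 < e"
    have "Inf ?A < Inf ?A + ennreal (e / 2)" "Inf ?B < Inf ?B + ennreal (e / 2)"
      using fin \<open>0 < e\<close> unfolding T_norm_def ennreal_add_less_top by (intro less_add; simp)+
    then obtain s s' where "s \<in> ?A" "s < Inf ?A + ennreal (e / 2)"
        "s' \<in> ?B" "s' < Inf ?B + ennreal (e / 2)"
      unfolding Inf_less_iff by blast
    then have "T_norm m (\<lambda>p. u p + v p) \<le> (Inf ?A + ennreal (e / 2)) + (Inf ?B + ennreal (e / 2))"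
      using pair[of s s'] by (meson add_mono less_imp_le order_trans)
    also have "\<dots> = Inf ?A + Inf ?B + ennreal e"
      using \<open>0 < e\<close> by (simp add: ac_simps flip: ennreal_plus)
    finally show "T_norm m (\<lambda>p. u p + v p) \<le> T_norm m u + T_norm m v + ennreal e"
      by (simp add: T_norm_def)
  qed
qed

lemma T_norm_cong_mae:
  assumes "mae m (\<lambda>p. u p = v p)"
  shows "T_norm m u = T_norm m v"
proof -
  have "T_representation m u' a b" if "T_representation m u a b" "mae m (\<lambda>p. u p = u' p)" for a b u u'
  proof -
    have "mae m (\<lambda>(x, y). (\<lambda>n. a n x * b n y) sums u' (x, y))"
      by (rule mae_mp2[OF _ that(2), where P = "\<lambda>(x, y). (\<lambda>n. a n x * b n y) sums u (x, y)"])
         (use that(1) in \<open>auto simp: T_representation_def\<close>)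
    then show ?thesis
      using that(1) by (simp add: T_representation_def)
  qed
  moreover have "mae m (\<lambda>p. v p = u p)"
    using assms by (rule mae_mono) simp
  ultimately have "T_representation m u a b \<longleftrightarrow> T_representation m v a b" for a b
    using assms by blast
  then show ?thesis
    by (simp add: T_norm_def)
qed

definition rho :: "(nat \<Rightarrow> 'a \<Rightarrow> complex) \<Rightarrow> 'a \<Rightarrow> ennreal" where
  "rho a x = (\<Sum>n. ennreal ((cmod (a n x))\<^sup>2))"

lemma borel_measurable_rho [measurable (raw)]:
  "(\<And>n. a n \<in> borel_measurable m) \<Longrightarrow> rho a \<in> borel_measurable m"
  unfolding rho_def by measurable

text \<open>
  The workhorse estimate. By the arithmetic-geometric mean inequality
  \<open>\<parallel>a\<^sub>n\<parallel> \<parallel>b\<^sub>n\<parallel> \<le> \<parallel>a\<^sub>n\<parallel>\<^sup>2 / e + e \<parallel>b\<^sub>n\<parallel>\<^sup>2\<close>, and the weight \<open>e\<close> is what later turns the smallness of one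
  factor into smallness of the product.
\<close>

lemma T_norm_le_rho:
  assumes meas: "\<And>n. a n \<in> borel_measurable m" "\<And>n. b n \<in> borel_measurable m"
    and fin: "(\<integral>\<^sup>+x. rho a x \<partial>m) < \<infinity>" "(\<integral>\<^sup>+x. rho b x \<partial>m) < \<infinity>"
    and sums: "mae m (\<lambda>(x, y). (\<lambda>n. a n x * b n y) sums u (x, y))"
    and "0 < e"
  shows "T_norm m u \<le> ennreal (1 / e) * (\<integral>\<^sup>+x. rho a x \<partial>m) + ennreal e * (\<integral>\<^sup>+x. rho b x \<partial>m)"
proof -
  have *: "(\<forall>n. in_L2 m (c n)) \<and> (\<lambda>n. (L2_nrm m (c n))\<^sup>2) sums enn2real (\<integral>\<^sup>+x. rho c x \<partial>m)"
    if m: "\<And>n. c n \<in> borel_measurable m" and f: "(\<integral>\<^sup>+x. rho c x \<partial>m) < \<infinity>" for c :: "nat \<Rightarrow> 'a \<Rightarrow> complex"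
  proof -
    let ?I = "\<lambda>n. \<integral>\<^sup>+x. ennreal ((cmod (c n x))\<^sup>2) \<partial>m"
    have eq: "(\<integral>\<^sup>+x. rho c x \<partial>m) = (\<Sum>n. ?I n)"
      unfolding rho_def by (rule nn_integral_suminf) (use m in measurable)
    have lt: "?I n < \<infinity>" for n
      using f unfolding eq by (rule ennreal_suminf_lessD)
    have L2: "in_L2 m (c n)" for n
      unfolding in_L2_def integrable_iff_bounded using m[of n] lt[of n] by simp
    have "ennreal ((L2_nrm m (c n))\<^sup>2) = ?I n" for n
      using L2[of n] unfolding in_L2_def L2_nrm_def
      by (subst nn_integral_eq_integral) auto
    then have "(\<Sum>n. ennreal ((L2_nrm m (c n))\<^sup>2)) = (\<integral>\<^sup>+x. rho c x \<partial>m)"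
      unfolding eq by simp
    then have "summable (\<lambda>n. (L2_nrm m (c n))\<^sup>2)"
        "ennreal (\<Sum>n. (L2_nrm m (c n))\<^sup>2) = (\<integral>\<^sup>+x. rho c x \<partial>m)"
      using f summable_suminf_not_top[of "\<lambda>n. (L2_nrm m (c n))\<^sup>2"] suminf_ennreal[of "\<lambda>n. (L2_nrm m (c n))\<^sup>2"] by auto
    then show ?thesis
      using L2 by (metis enn2real_ennreal suminf_nonneg summable_sums zero_le_power2)
  qed
  note A = *[OF meas(1) fin(1)] and B = *[OF meas(2) fin(2)]
  let ?A = "enn2real (\<integral>\<^sup>+x. rho a x \<partial>m)" and ?B = "enn2real (\<integral>\<^sup>+x. rho b x \<partial>m)"
  have sum2: "(\<lambda>n. 1 / e * (L2_nrm m (a n))\<^sup>2 + e * (L2_nrm m (b n))\<^sup>2) sums (1 / e * ?A + e * ?B)"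
    using A B by (intro sums_add sums_mult) auto
  have le: "L2_nrm m (a n) * L2_nrm m (b n) \<le> 1 / e * (L2_nrm m (a n))\<^sup>2 + e * (L2_nrm m (b n))\<^sup>2" for n
  proof -
    define p q where "p = L2_nrm m (a n)" and "q = L2_nrm m (b n)"
    have "0 \<le> (p - e * q)\<^sup>2" "0 \<le> p * q * e"
      using \<open>0 < e\<close> by (simp_all add: p_def q_def L2_nrm_def)
    moreover have "(p - e * q)\<^sup>2 = p\<^sup>2 + e * q\<^sup>2 * e - 2 * (p * q * e)"
      by (simp add: power2_eq_square algebra_simps)
    ultimately have "p * q * e \<le> p\<^sup>2 + e * q\<^sup>2 * e"
      by linarith
    then have "p * q \<le> 1 / e * p\<^sup>2 + e * q\<^sup>2"
      using \<open>0 < e\<close> by (simp add: field_simps)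
    then show ?thesis by (simp add: p_def q_def)
  qed
  have summ: "summable (\<lambda>n. L2_nrm m (a n) * L2_nrm m (b n))"
    by (rule summable_comparison_test'[OF sums_summable[OF sum2], of 0])
       (use le in \<open>auto simp: L2_nrm_def\<close>)
  have "T_representation m u a b"
    using A B summ sums by (auto simp: T_representation_def)
  then have "T_norm m u \<le> ennreal (\<Sum>n. L2_nrm m (a n) * L2_nrm m (b n))"
    by (rule T_norm_le)
  also have "\<dots> \<le> ennreal (1 / e * ?A + e * ?B)"
    using sums_le[OF le summable_sums[OF summ] sum2] by (rule ennreal_leI)
  also have "\<dots> = ennreal (1 / e) * (\<integral>\<^sup>+x. rho a x \<partial>m) + ennreal e * (\<integral>\<^sup>+x. rho b x \<partial>m)"
    using fin \<open>0 < e\<close> by (simp add: ennreal_mult del: times_divide_eq_left)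
  finally show ?thesis .
qed

lemma T_norm_zero: "T_norm m (\<lambda>p. 0) = 0"
proof -
  have "T_norm m (\<lambda>p. 0) \<le> ennreal (1 / 1) * (\<integral>\<^sup>+x. rho (\<lambda>n x. 0) x \<partial>m)
      + ennreal 1 * (\<integral>\<^sup>+x. rho (\<lambda>n x. 0) x \<partial>m)"
    by (rule T_norm_le_rho) (auto simp: rho_def intro!: mae_everywhere)
  then show ?thesis by (simp add: rho_def)
qed

lemma T_norm_sum:
  assumes "finite I"
  shows "T_norm m (\<lambda>p. \<Sum>i\<in>I. u i p) \<le> (\<Sum>i\<in>I. T_norm m (u i))"
  using assms
proof induction
  case empty
  then show ?case by (simp add: T_norm_zero)
next
  case (insert i I)
  then have "T_norm m (\<lambda>p. \<Sum>i\<in>insert i I. u i p) \<le> T_norm m (u i) + T_norm m (\<lambda>p. \<Sum>i\<in>I. u i p)"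
    using T_norm_add[of m "u i" "\<lambda>p. \<Sum>i\<in>I. u i p"] by simp
  also have "\<dots> \<le> (\<Sum>i\<in>insert i I. T_norm m (u i))"
    using insert by (simp add: add_left_mono)
  finally show ?case .
qed

section \<open>Compact sets filling up a finite measure\<close>

locale outer_regular_measure =
  fixes m :: "'a::{t2_space, second_countable_topology} measure"
  assumes sets_eq_borel: "sets m = sets borel"
    and compact_finite: "compact K \<Longrightarrow> emeasure m K < \<infinity>"
    and outer_regular: "A \<in> sets m \<Longrightarrow> emeasure m A = (INF U\<in>{U. open U \<and> A \<subseteq> U}. emeasure m U)"
    and locally_compact: "locally compact (UNIV :: 'a set)"
begin

lemma space_eq_UNIV: "space m = UNIV"
  using sets_eq_imp_space_eq[OF sets_eq_borel] by simp

lemma sigma_compact: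
  obtains V :: "nat \<Rightarrow> 'a set" where "\<And>n. compact (V n)" "(\<Union>n. V n) = UNIV"
proof -
  have "\<exists>U V. open U \<and> compact V \<and> x \<in> U \<and> U \<subseteq> V" for x :: 'a
  proof -
    have "openin (top_of_set UNIV) (UNIV :: 'a set) \<and> x \<in> UNIV" by simp
    then obtain U V where "openin (top_of_set UNIV) U" "compact V" "x \<in> U" "U \<subseteq> V"
      using locally_compact unfolding locally_def by meson
    then show ?thesis by (auto simp flip: open_openin)
  qed
  then obtain U V where UV: "\<And>x::'a. open (U x)" "\<And>x. compact (V x)" "\<And>x. x \<in> U x" "\<And>x. U x \<subseteq> V x"
    by metis
  have "\<And>S. S \<in> range U \<Longrightarrow> openin (top_of_set UNIV) S"
    using UV(1) by (auto simp flip: open_openin)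
  from Lindelof_openin[OF this] obtain \<F> where F: "\<F> \<subseteq> range U" "countable \<F>" "\<Union>\<F> = \<Union>(range U)"
    by blast
  from F(1,2) obtain X where X: "countable X" "\<F> = U ` X"
    using countable_subset_image[of \<F> U UNIV] by blast
  have cover: "(\<Union>x\<in>X. V x) = UNIV"
  proof -
    have "x \<in> (\<Union>x\<in>X. V x)" for x
    proof -
      have "x \<in> \<Union>\<F>" unfolding F(3) using UV(3) by blast
      then show ?thesis unfolding X(2) using UV(4) by blast
    qed
    then show ?thesis by blast
  qed
  then have "X \<noteq> {}" by auto
  show ?thesis
  proof
    show "compact (V (from_nat_into X n))" for n by (rule UV)
    show "(\<Union>n. V (from_nat_into X n)) = UNIV"
      using cover range_from_nat_into[OF \<open>X \<noteq> {}\<close> X(1)] by (metis image_image)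
  qed
qed

text \<open>
  Inside a compact set, passing to complements turns outer into inner regularity.
\<close>

lemma inner_regular_in_compact:
  assumes "A \<in> sets m" "compact V" "0 < (e::ennreal)"
  obtains C where "compact C" "C \<subseteq> A \<inter> V" "emeasure m (A \<inter> V - C) < e"
proof -
  have V: "V \<in> sets m"
    using assms(2) by (simp add: sets_eq_borel borel_closed compact_imp_closed)
  have VA: "V - A \<in> sets m" using V assms(1) by auto
  have fin: "emeasure m (V - A) < \<infinity>"
    using compact_finite[OF assms(2)] emeasure_mono[of "V - A" V m] V by (auto intro: le_less_trans)
  then have "(INF U\<in>{U. open U \<and> V - A \<subseteq> U}. emeasure m U) < emeasure m (V - A) + e"
    using ennreal_add_left_cancel_less[of "emeasure m (V - A)" 0 e] assms(3)
    unfolding outer_regular[OF VA, symmetric] by simp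
  then obtain U where U: "open U" "V - A \<subseteq> U" "emeasure m U < emeasure m (V - A) + e"
    by (auto simp: Inf_less_iff)
  have Us: "U \<in> sets m" using U(1) by (simp add: sets_eq_borel)
  show ?thesis
  proof
    show "compact (V - U)" using assms(2) U(1) by (rule compact_diff)
    show "V - U \<subseteq> A \<inter> V" using U(2) by auto
    have "emeasure m (A \<inter> V - (V - U)) \<le> emeasure m (U - (V - A))"
      using Us VA by (intro emeasure_mono) auto
    also have "\<dots> = emeasure m U - emeasure m (V - A)"
      using U(2) VA Us fin by (intro emeasure_Diff) auto
    also have "\<dots> < e"
      using U(3) fin emeasure_mono[OF U(2) Us]
        ennreal_add_left_cancel_less[of "emeasure m (V - A)" "emeasure m U - emeasure m (V - A)" e]
      by (simp add: add_diff_self_ennreal)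
    finally show "emeasure m (A \<inter> V - (V - U)) < e" .
  qed
qed

text \<open>
  Every Borel set is, up to an \<open>m\<close>-null set, a countable union of compact sets; continuity from
  above of the finite measure \<open>P\<close> then makes finitely many of them suffice.
\<close>

lemma inner_regular_absolutely_continuous:
  assumes P: "sets P = sets m" "finite_measure P" "absolutely_continuous m P"
    and A: "A \<in> sets m" and e: "0 < (e::ennreal)"
  obtains C where "compact C" "C \<subseteq> A" "emeasure P (A - C) < e"
proof -
  interpret finite_measure P by fact
  obtain V :: "nat \<Rightarrow> 'a set" where V: "\<And>n. compact (V n)" "(\<Union>n. V n) = UNIV"
    using sigma_compact by blast
  have "\<exists>C. compact C \<and> C \<subseteq> A \<inter> V n \<and> emeasure m (A \<inter> V n - C) < ennreal (inverse (real (Suc j)))" for n j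
  proof -
    have "0 < ennreal (inverse (real (Suc j)))" by simp
    show ?thesis
      by (rule inner_regular_in_compact[OF A V(1)[of n] \<open>0 < ennreal (inverse (real (Suc j)))\<close>])
         (intro exI conjI)
  qed
  then obtain C where C: "\<And>n j. compact (C n j)" "\<And>n j. C n j \<subseteq> A \<inter> V n"
      "\<And>n j. emeasure m (A \<inter> V n - C n j) < ennreal (inverse (real (Suc j)))"
    by metis
  have meas: "B \<in> sets m" if "compact B" for B
    using that by (simp add: sets_eq_borel borel_closed compact_imp_closed)
  have null: "A \<inter> V n - (\<Union>j. C n j) \<in> null_sets m" for n
  proof (rule null_setsI)
    show s: "A \<inter> V n - (\<Union>j. C n j) \<in> sets m"
      using A meas[OF V(1)] meas[OF C(1)] by auto
    have "emeasure m (A \<inter> V n - (\<Union>j. C n j)) \<le> ennreal (inverse (real (Suc j)))" for j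
    proof -
      have "emeasure m (A \<inter> V n - (\<Union>j. C n j)) \<le> emeasure m (A \<inter> V n - C n j)"
        using A meas[OF V(1)] meas[OF C(1)] by (intro emeasure_mono) auto
      with C(3)[of n j] show ?thesis by simp
    qed
    moreover have "(\<lambda>j. ennreal (inverse (real (Suc j)))) \<longlonglongrightarrow> ennreal 0"
      by (intro tendsto_ennrealI LIMSEQ_inverse_real_of_nat)
    ultimately have "emeasure m (A \<inter> V n - (\<Union>j. C n j)) \<le> ennreal 0"
      by (intro LIMSEQ_le_const) auto
    then show "emeasure m (A \<inter> V n - (\<Union>j. C n j)) = 0" by simp
  qed
  define D where "D p = (\<Union>q\<le>p. case prod_decode q of (n, j) \<Rightarrow> C n j)" for p
  have D: "compact (D p)" "D p \<subseteq> A" for p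
  proof -
    show "compact (D p)"
      unfolding D_def using C(1) by (intro compact_UN) (auto split: prod.splits)
    show "D p \<subseteq> A"
      unfolding D_def using C(2) by (fastforce split: prod.splits)
  qed
  have sub: "A - (\<Union>p. D p) \<subseteq> (\<Union>n. A \<inter> V n - (\<Union>j. C n j))"
  proof
    fix x assume x: "x \<in> A - (\<Union>p. D p)"
    obtain n where n: "x \<in> V n" using V(2) by blast
    have "x \<notin> C n j" for j
    proof
      assume "x \<in> C n j"
      then have "x \<in> D (prod_encode (n, j))" by (force simp: D_def)
      with x show False by blast
    qed
    with x n show "x \<in> (\<Union>n. A \<inter> V n - (\<Union>j. C n j))" by blast
  qed
  have "(\<Union>n. A \<inter> V n - (\<Union>j. C n j)) \<in> null_sets m"
    using null by (rule null_sets_UN)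
  moreover have "A - (\<Union>p. D p) \<in> sets m"
    using A meas[OF D(1)] by auto
  ultimately have "A - (\<Union>p. D p) \<in> null_sets m"
    using sub by (rule null_sets_subset)
  then have "A - (\<Union>p. D p) \<in> null_sets P"
    using P(3) unfolding absolutely_continuous_def by (rule subsetD[rotated])
  moreover have "(\<Inter>p. A - D p) = A - (\<Union>p. D p)" by auto
  ultimately have 0: "emeasure P (\<Inter>p. A - D p) = 0"
    by (simp only: null_setsD1)
  have "(\<lambda>p. emeasure P (A - D p)) \<longlonglongrightarrow> emeasure P (\<Inter>p. A - D p)"
  proof (rule Lim_emeasure_decseq)
    show "range (\<lambda>p. A - D p) \<subseteq> sets P" using A meas[OF D(1)] P(1) by auto
    show "decseq (\<lambda>p. A - D p)" 
      unfolding decseq_def D_def by (intro allI impI Diff_mono UN_mono) auto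
  qed simp
  then have "eventually (\<lambda>p. emeasure P (A - D p) < e) sequentially"
    using e unfolding 0 by (rule order_tendstoD)
  then obtain p where "emeasure P (A - D p) < e"
    by (auto simp: eventually_sequentially)
  with D that show ?thesis by blast
qed

text \<open>
  The set form of Lusin's theorem. Every \<open>A j\<close> and its complement are approximated from inside by
  compact sets \<open>C j\<close> and \<open>D j\<close>; on the intersection of all \<open>C j \<union> D j\<close> the set \<open>A j\<close> is cut out by
  the open set \<open>- D j\<close>.
\<close>

lemma lusin_sets:
  fixes A :: "nat \<Rightarrow> 'a set"
  assumes P: "sets P = sets m" "finite_measure P" "absolutely_continuous m P"
    and A: "\<And>j. A j \<in> sets m" and e: "0 < (e::real)"
  obtains K where "compact K" "emeasure P (- K) \<le> ennreal e" "\<And>j. \<exists>U. open U \<and> K \<inter> A j = K \<inter> U"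
proof -
  have pos: "0 < ennreal (e * (1/2) ^ Suc (Suc j))" for j
    using e by simp
  have "\<exists>C. compact C \<and> C \<subseteq> A j \<and> emeasure P (A j - C) < ennreal (e * (1/2) ^ Suc (Suc j))" for j
    by (rule inner_regular_absolutely_continuous[OF P A pos[of j], of j]) (intro exI conjI)
  then obtain C where C: "\<And>j. compact (C j)" "\<And>j. C j \<subseteq> A j"
      "\<And>j. emeasure P (A j - C j) < ennreal (e * (1/2) ^ Suc (Suc j))"
    by metis
  have nA: "- A j \<in> sets m" for j
    using sets.compl_sets[OF A[of j]] by (simp only: space_eq_UNIV Compl_eq_Diff_UNIV)
  have "\<exists>C. compact C \<and> C \<subseteq> - A j \<and> emeasure P (- A j - C) < ennreal (e * (1/2) ^ Suc (Suc j))" for j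
    by (rule inner_regular_absolutely_continuous[OF P nA pos[of j], of j]) (intro exI conjI)
  then obtain D where D: "\<And>j. compact (D j)" "\<And>j. D j \<subseteq> - A j"
      "\<And>j. emeasure P (- A j - D j) < ennreal (e * (1/2) ^ Suc (Suc j))"
    by metis
  have meas: "B \<in> sets P" if "compact B" for B
    using that by (simp add: P(1) sets_eq_borel borel_closed compact_imp_closed)
  define K where "K = (\<Inter>j. C j \<union> D j)"
  have "compact K"
  proof -
    have "K = (C 0 \<union> D 0) \<inter> K" by (auto simp: K_def)
    moreover have "closed K"
      unfolding K_def
      by (intro closed_INT ballI closed_Un) (simp_all add: compact_imp_closed C(1) D(1))
    ultimately show ?thesis
      using C(1) D(1) by (metis compact_Int_closed compact_Un)
  qed
  moreover have "emeasure P (- K) \<le> ennreal e"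
  proof -
    have "emeasure P (- K) \<le> emeasure P (\<Union>j. - (C j \<union> D j))"
      unfolding K_def by simp
    also have "\<dots> \<le> (\<Sum>j. emeasure P (- (C j \<union> D j)))"
      using meas[OF C(1)] meas[OF D(1)]
      by (intro emeasure_subadditive_countably) (auto simp: P(1) sets_eq_borel)
    also have "\<dots> \<le> (\<Sum>j. ennreal (e * (1/2) ^ Suc j))"
    proof (rule suminf_le)
      fix j
      have "emeasure P (- (C j \<union> D j)) \<le> emeasure P ((A j - C j) \<union> (- A j - D j))"
        using A nA meas C(1) D(1) by (intro emeasure_mono) (auto simp: P(1))
      also have "\<dots> \<le> emeasure P (A j - C j) + emeasure P (- A j - D j)"
        using A nA meas C(1) D(1) by (intro emeasure_subadditive) (auto simp: P(1))
      also have "\<dots> \<le> ennreal (e * (1/2) ^ Suc (Suc j)) + ennreal (e * (1/2) ^ Suc (Suc j))"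
        using C(3)[of j] D(3)[of j] by (intro add_mono) auto
      also have "\<dots> = ennreal (e * (1/2) ^ Suc j)"
        using e by (simp flip: ennreal_plus)
      finally show "emeasure P (- (C j \<union> D j)) \<le> ennreal (e * (1/2) ^ Suc j)" .
    qed auto
    also have "\<dots> = ennreal e"
    proof (rule suminf_ennreal_eq)
      show "(\<lambda>j. e * (1/2) ^ Suc j) sums e"
        using sums_mult[OF power_half_series, of e] by simp
    qed (use e in auto)
    finally show ?thesis .
  qed
  moreover have "\<exists>U. open U \<and> K \<inter> A j = K \<inter> U" for j
  proof (intro exI conjI)
    show "open (- D j)" using D(1) by (simp add: compact_imp_closed open_Compl)
    show "K \<inter> A j = K \<inter> - D j"
      using C(2)[of j] D(2)[of j] by (auto simp: K_def)
  qed
  ultimately show ?thesis using that by blast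
qed

text \<open>Lusin's theorem follows by making the preimages of a countable base relatively open.\<close>

lemma lusin_functions:
  fixes H :: "('a \<Rightarrow> complex) set"
  assumes P: "sets P = sets m" "finite_measure P" "absolutely_continuous m P"
    and H: "countable H" "\<And>h. h \<in> H \<Longrightarrow> h \<in> borel_measurable m" and e: "0 < (e::real)"
  obtains K where "compact K" "emeasure P (- K) \<le> ennreal e" "\<And>h. h \<in> H \<Longrightarrow> continuous_on K h"
proof -
  obtain B :: "complex set set" where B: "countable B" "topological_basis B"
    using ex_countable_basis by blast
  define \<A> where "\<A> = insert {} ((\<lambda>(h, b). h -` b) ` (H \<times> B))"
  have count: "countable \<A>" "\<A> \<noteq> {}"
    using H(1) B(1) by (auto simp: \<A>_def)
  have "A \<in> sets m" if "A \<in> \<A>" for A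
  proof -
    have "h -` b \<in> sets m" if "h \<in> H" "b \<in> B" for h b
      using measurable_sets[OF H(2)[OF that(1)], of b] topological_basis_open[OF B(2) that(2)]
      by (simp add: space_eq_UNIV)
    then show ?thesis using that by (auto simp: \<A>_def)
  qed
  then have "from_nat_into \<A> j \<in> sets m" for j
    using from_nat_into[OF count(2)] by blast
  then obtain K where K: "compact K" "emeasure P (- K) \<le> ennreal e"
      "\<And>j. \<exists>U. open U \<and> K \<inter> from_nat_into \<A> j = K \<inter> U"
    using lusin_sets[OF P _ e, of "from_nat_into \<A>"] by blast
  have "continuous_on K h" if h: "h \<in> H" for h
  proof -
    have basic: "\<exists>U. open U \<and> K \<inter> h -` b = K \<inter> U" if "b \<in> B" for b
    proof -
      have "h -` b \<in> \<A>" using h that by (force simp: \<A>_def)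
      then obtain j where "from_nat_into \<A> j = h -` b"
        using from_nat_into_surj[OF count(1)] by blast
      then show ?thesis using K(3)[of j] by simp
    qed
    show ?thesis
      unfolding continuous_on_open_invariant
    proof (intro allI impI)
      fix S :: "complex set" assume "open S"
      then obtain B' where B': "B' \<subseteq> B" "S = \<Union>B'"
        using B(2) unfolding topological_basis_def by metis
      have "\<forall>b\<in>B'. \<exists>U. open U \<and> K \<inter> h -` b = K \<inter> U" using basic B'(1) by blast
      then obtain U where "\<And>b. b \<in> B' \<Longrightarrow> open (U b) \<and> K \<inter> h -` b = K \<inter> U b" by metis
      then have "open (\<Union>b\<in>B'. U b)" "(\<Union>b\<in>B'. U b) \<inter> K = h -` S \<inter> K"
        unfolding B'(2) by blast+
      then show "\<exists>A. open A \<and> A \<inter> K = h -` S \<inter> K" by blast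
    qed
  qed
  with K(1,2) show ?thesis by (rule that)
qed

end

section \<open>Square-summable representations\<close>

text \<open>
  With \<open>q n\<close> the norm of the other factor of an elementary tensor, multiplying \<open>f n\<close> by
  \<open>sqrt (q n / p n)\<close> makes its squared norm \<open>p n * q n\<close>, which is symmetric in the two factors.
\<close>

lemma rescale_factor:
  assumes L2: "\<And>n. in_L2 m (f n)" and p: "\<And>n. p n = L2_nrm m (f n)"
    and q: "\<And>n. 0 \<le> q n" "summable (\<lambda>n. p n * q n)"
  obtains a :: "nat \<Rightarrow> 'a \<Rightarrow> complex" and M
  where "\<And>n. a n \<in> borel_measurable m" "M \<in> null_sets m" "(\<integral>\<^sup>+x. rho a x \<partial>m) < \<infinity>"
    "\<And>x. x \<in> space m - M \<Longrightarrow> rho a x < \<infinity>"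
    "\<And>x n. x \<in> space m - M \<Longrightarrow> p n = 0 \<Longrightarrow> f n x = 0"
    "\<And>n x. a n x = (if p n = 0 \<or> q n = 0 then 0 else complex_of_real (sqrt (q n / p n)) * f n x)"
proof -
  define a where "a n x = (if p n = 0 \<or> q n = 0 then 0 else complex_of_real (sqrt (q n / p n)) * f n x)" for n x
  have p0: "0 \<le> p n" for n by (simp add: p L2_nrm_def)
  have [measurable]: "f n \<in> borel_measurable m" for n
    using L2[of n] by (simp add: in_L2_def)
  have [measurable]: "a n \<in> borel_measurable m" for n
    unfolding a_def by measurable
  have sq: "(\<integral>\<^sup>+x. ennreal ((cmod (f n x))\<^sup>2) \<partial>m) = ennreal ((p n)\<^sup>2)" for n
    using L2[of n] unfolding in_L2_def p L2_nrm_def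
    by (subst nn_integral_eq_integral) auto
  have "(\<integral>\<^sup>+x. ennreal ((cmod (a n x))\<^sup>2) \<partial>m) = ennreal (p n * q n)" for n
  proof (cases "p n = 0 \<or> q n = 0")
    case False
    then have "0 < p n" "0 < q n" using p0[of n] q(1)[of n] by auto
    then have "(\<integral>\<^sup>+x. ennreal ((cmod (a n x))\<^sup>2) \<partial>m)
        = (\<integral>\<^sup>+x. ennreal (q n / p n) * ennreal ((cmod (f n x))\<^sup>2) \<partial>m)"
      by (intro nn_integral_cong)
         (auto simp: a_def norm_mult power_mult_distrib simp flip: ennreal_mult)
    also have "\<dots> = ennreal (q n / p n) * ennreal ((p n)\<^sup>2)"
      by (subst nn_integral_cmult) (simp_all add: sq)
    also have "\<dots> = ennreal (p n * q n)"
      using \<open>0 < p n\<close> \<open>0 < q n\<close> by (simp flip: ennreal_mult add: power2_eq_square)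
    finally show ?thesis .
  qed (auto simp: a_def)
  then have "(\<integral>\<^sup>+x. rho a x \<partial>m) = (\<Sum>n. ennreal (p n * q n))"
    unfolding rho_def by (subst nn_integral_suminf) auto
  moreover have "(\<Sum>n. ennreal (p n * q n)) \<noteq> top"
    using p0 q(1) by (intro ennreal_suminf_neq_top[OF q(2)]) simp
  ultimately have fin: "(\<integral>\<^sup>+x. rho a x \<partial>m) < \<infinity>"
    by (simp only: infinity_ennreal_def less_top)
  have "AE x in m. rho a x \<noteq> \<infinity>"
    using fin by (intro nn_integral_noteq_infinite) auto
  moreover have "AE x in m. \<forall>n. p n = 0 \<longrightarrow> f n x = 0"
    unfolding AE_all_countable
  proof
    fix n
    show "AE x in m. p n = 0 \<longrightarrow> f n x = 0"
    proof (cases "p n = 0")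
      case True
      then have "(\<integral>\<^sup>+x. ennreal ((cmod (f n x))\<^sup>2) \<partial>m) = 0" using sq[of n] by simp
      then have "AE x in m. ennreal ((cmod (f n x))\<^sup>2) = 0"
        by (subst (asm) nn_integral_0_iff_AE) auto
      then show ?thesis by eventually_elim simp
    qed simp
  qed
  ultimately have "AE x in m. rho a x \<noteq> \<infinity> \<and> (\<forall>n. p n = 0 \<longrightarrow> f n x = 0)"
    by eventually_elim simp
  then obtain M where M: "M \<in> null_sets m" "{x \<in> space m. \<not> (rho a x \<noteq> \<infinity> \<and> (\<forall>n. p n = 0 \<longrightarrow> f n x = 0))} \<subseteq> M"
    unfolding eventually_ae_filter by auto
  show ?thesis
  proof (rule that[of a M])
    fix x assume "x \<in> space m - M"
    with M(2) have "rho a x \<noteq> \<infinity> \<and> (\<forall>n. p n = 0 \<longrightarrow> f n x = 0)" by blast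
    then show "rho a x < \<infinity>" "\<And>n. p n = 0 \<Longrightarrow> f n x = 0"
      unfolding infinity_ennreal_def less_top by blast+
  qed (use M fin in \<open>auto simp: a_def\<close>)
qed

text \<open>
  Rescaling gives every elementary tensor two factors of equal norm, so the cost of the
  representation becomes \<open>\<integral> rho a = \<integral> rho b\<close>. Setting the factors to zero on the exceptional null
  sets then makes the square sums finite everywhere and the expansion zero on all of \<open>E\<close>.
\<close>

lemma Phi_space_square_summable:
  assumes "w \<in> Phi_space m E"
  obtains a b :: "nat \<Rightarrow> 'a \<Rightarrow> complex"
  where "\<And>n. a n \<in> borel_measurable m" "\<And>n. b n \<in> borel_measurable m"
    "(\<integral>\<^sup>+x. rho a x \<partial>m) < \<infinity>" "(\<integral>\<^sup>+y. rho b y \<partial>m) < \<infinity>"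
    "\<And>x. x \<in> space m \<Longrightarrow> rho a x < \<infinity>" "\<And>y. y \<in> space m \<Longrightarrow> rho b y < \<infinity>"
    "mae m (\<lambda>(x, y). (\<lambda>n. a n x * b n y) sums w (x, y))"
    "\<And>x y. (x, y) \<in> E \<Longrightarrow> x \<in> space m \<Longrightarrow> y \<in> space m \<Longrightarrow> (\<lambda>n. a n x * b n y) sums 0"
proof -
  obtain f g where rep: "T_representation m w f g" and van: "mae m (\<lambda>p. p \<in> E \<longrightarrow> w p = 0)"
    using assms unfolding Phi_space_def T_space_def by blast
  define s t where "s n = L2_nrm m (f n)" and "t n = L2_nrm m (g n)" for n
  have st0: "0 \<le> s n" "0 \<le> t n" for n by (simp_all add: s_def t_def L2_nrm_def)
  have L2: "in_L2 m (f n)" "in_L2 m (g n)" and summ: "summable (\<lambda>n. s n * t n)"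
    and sums: "mae m (\<lambda>(x, y). (\<lambda>n. f n x * g n y) sums w (x, y))" for n
    using rep by (auto simp: T_representation_def s_def t_def)
  obtain a0 M0 where a0: "\<And>n. a0 n \<in> borel_measurable m" "M0 \<in> null_sets m" "(\<integral>\<^sup>+x. rho a0 x \<partial>m) < \<infinity>"
    "\<And>x. x \<in> space m - M0 \<Longrightarrow> rho a0 x < \<infinity>"
    "\<And>x n. x \<in> space m - M0 \<Longrightarrow> s n = 0 \<Longrightarrow> f n x = 0"
    "\<And>n x. a0 n x = (if s n = 0 \<or> t n = 0 then 0 else complex_of_real (sqrt (t n / s n)) * f n x)"
    by (rule rescale_factor[OF L2(1) s_def st0(2) summ]) blast
  have summ': "summable (\<lambda>n. t n * s n)" using summ by (simp add: mult.commute)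
  obtain b0 N0 where b0: "\<And>n. b0 n \<in> borel_measurable m" "N0 \<in> null_sets m" "(\<integral>\<^sup>+x. rho b0 x \<partial>m) < \<infinity>"
    "\<And>x. x \<in> space m - N0 \<Longrightarrow> rho b0 x < \<infinity>"
    "\<And>x n. x \<in> space m - N0 \<Longrightarrow> t n = 0 \<Longrightarrow> g n x = 0"
    "\<And>n x. b0 n x = (if t n = 0 \<or> s n = 0 then 0 else complex_of_real (sqrt (s n / t n)) * g n x)"
    by (rule rescale_factor[OF L2(2) t_def st0(1) summ']) blast
  have "mae m (\<lambda>(x, y). (\<lambda>n. f n x * g n y) sums w (x, y) \<and> ((x, y) \<in> E \<longrightarrow> w (x, y) = 0))"
    by (rule mae_mp2[OF sums van]) auto
  then obtain M1 N1 where MN: "M1 \<in> null_sets m" "N1 \<in> null_sets m"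
    "\<And>x y. x \<in> space m - M1 \<Longrightarrow> y \<in> space m - N1 \<Longrightarrow>
        (\<lambda>n. f n x * g n y) sums w (x, y) \<and> ((x, y) \<in> E \<longrightarrow> w (x, y) = 0)"
    by (rule maeE) simp
  define M N where "M = M0 \<union> M1" and "N = N0 \<union> N1"
  have null: "M \<in> null_sets m" "N \<in> null_sets m"
    using a0 b0 MN by (auto simp: M_def N_def)
  then have [measurable]: "M \<in> sets m" "N \<in> sets m" by auto
  note [measurable] = a0(1) b0(1)
  define a b where "a n x = (if x \<in> M then 0 else a0 n x)" and "b n x = (if x \<in> N then 0 else b0 n x)" for n x
  have prod: "a n x * b n y = f n x * g n y" if "x \<in> space m - M" "y \<in> space m - N" for n x y
  proof -
    have one: "complex_of_real (sqrt (t n / s n)) * complex_of_real (sqrt (s n / t n)) = 1" if "s n \<noteq> 0" "t n \<noteq> 0"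
      using that st0[of n] by (simp flip: of_real_mult real_sqrt_mult)
    have "complex_of_real (sqrt (t n / s n)) * f n x * (complex_of_real (sqrt (s n / t n)) * g n y) = f n x * g n y"
      if "s n \<noteq> 0" "t n \<noteq> 0"
    proof -
      have "complex_of_real (sqrt (t n / s n)) * f n x * (complex_of_real (sqrt (s n / t n)) * g n y)
          = (complex_of_real (sqrt (t n / s n)) * complex_of_real (sqrt (s n / t n))) * (f n x * g n y)"
        by (simp only: ac_simps)
      then show ?thesis using one[OF that] by simp
    qed
    then show ?thesis
      using that a0(5)[of x n] b0(5)[of y n] by (auto simp: a_def b_def a0(6) b0(6) M_def N_def)
  qed
  show ?thesis
  proof
    show "a n \<in> borel_measurable m" "b n \<in> borel_measurable m" for n
      unfolding a_def b_def by measurable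
    have le: "rho a x \<le> rho a0 x" "rho b x \<le> rho b0 x" for x
      by (auto simp: rho_def a_def b_def intro!: suminf_le)
    show "(\<integral>\<^sup>+x. rho a x \<partial>m) < \<infinity>" "(\<integral>\<^sup>+x. rho b x \<partial>m) < \<infinity>"
      using nn_integral_mono[of m "rho a" "rho a0"] nn_integral_mono[of m "rho b" "rho b0"]
        a0(3) b0(3) le by (auto intro: le_less_trans)
    have zero: "rho a x = 0" if "x \<in> M" for x
      using that by (simp add: rho_def a_def)
    have zero': "rho b x = 0" if "x \<in> N" for x
      using that by (simp add: rho_def b_def)
    show "rho a x < \<infinity>" if "x \<in> space m" for x
      using that zero[of x] a0(4)[of x] le(1)[of x] by (cases "x \<in> M") (auto simp: M_def intro: le_less_trans)
    show "rho b x < \<infinity>" if "x \<in> space m" for x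
      using that zero'[of x] b0(4)[of x] le(2)[of x] by (cases "x \<in> N") (auto simp: N_def intro: le_less_trans)
    have "marginally_null m {p \<in> space m \<times> space m. \<not> (case p of (x, y) \<Rightarrow> (\<lambda>n. a n x * b n y) sums w (x, y))}"
      unfolding marginally_null_def
    proof (rule bexI[OF _ null(1)], rule bexI[OF _ null(2)], safe)
      fix x y assume xy: "x \<in> space m" "y \<in> space m" "y \<notin> N" "\<not> (\<lambda>n. a n x * b n y) sums w (x, y)"
      show "x \<in> M"
      proof (rule ccontr)
        assume "x \<notin> M"
        then show False using prod[of x y] MN(3)[of x y] xy by (auto simp: M_def N_def)
      qed
    qed
    then show "mae m (\<lambda>(x, y). (\<lambda>n. a n x * b n y) sums w (x, y))"
      unfolding mae_def .
    fix x y assume xy: "(x, y) \<in> E" "x \<in> space m" "y \<in> space m"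
    show "(\<lambda>n. a n x * b n y) sums 0"
    proof (cases "x \<in> M \<or> y \<in> N")
      case True then show ?thesis by (auto simp: a_def b_def)
    next
      case False
      then show ?thesis using prod[of x y] MN(3)[of x y] xy by (auto simp: M_def N_def)
    qed
  qed
qed

section \<open>Continuity and compactness\<close>

lemma sq_norm_diff_le:
  fixes u v :: "'b::real_normed_vector"
  shows "(norm (u - v))\<^sup>2 \<le> 2 * (norm u)\<^sup>2 + 2 * (norm v)\<^sup>2"
proof -
  have "(norm (u - v))\<^sup>2 \<le> (norm u + norm v)\<^sup>2"
    by (intro power_mono norm_triangle_ineq4) auto
  also have "\<dots> \<le> 2 * (norm u)\<^sup>2 + 2 * (norm v)\<^sup>2"
    using sum_squares_bound[of "norm u" "norm v"] by (simp add: power2_sum)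
  finally show ?thesis .
qed

lemma summable_sq_diff:
  fixes u v :: "nat \<Rightarrow> complex"
  assumes "summable (\<lambda>n. (cmod (u n))\<^sup>2)" "summable (\<lambda>n. (cmod (v n))\<^sup>2)"
  shows "summable (\<lambda>n. (cmod (u n - v n))\<^sup>2)"
  by (rule summable_comparison_test'[OF summable_add[OF summable_mult[OF assms(1), of 2]
        summable_mult[OF assms(2), of 2]], of 0])
     (use sq_norm_diff_le in auto)

lemma summable_mult_of_sq:
  fixes u v :: "nat \<Rightarrow> complex"
  assumes "summable (\<lambda>n. (cmod (u n))\<^sup>2)" "summable (\<lambda>n. (cmod (v n))\<^sup>2)"
  shows "summable (\<lambda>n. cmod (u n * v n))"
proof (rule summable_comparison_test'[OF summable_add[OF assms], of 0])
  fix n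
  have "cmod (u n) * cmod (v n) \<le> (cmod (u n))\<^sup>2 + (cmod (v n))\<^sup>2"
    using sum_squares_bound[of "cmod (u n)" "cmod (v n)"]
      mult_nonneg_nonneg[OF norm_ge_zero norm_ge_zero, of "u n" "v n"]
    by linarith
  then show "norm (cmod (u n * v n)) \<le> (cmod (u n))\<^sup>2 + (cmod (v n))\<^sup>2"
    by (simp add: norm_mult)
qed

lemma suminf_sq_diff_le:
  fixes u v :: "nat \<Rightarrow> complex"
  assumes u: "summable (\<lambda>n. (cmod (u n))\<^sup>2)" and v: "summable (\<lambda>n. (cmod (v n))\<^sup>2)"
  shows "(\<Sum>n. (cmod (u n - v n))\<^sup>2) \<le> (\<Sum>n<N. (cmod (u n - v n))\<^sup>2)
    + 2 * (\<Sum>n. (cmod (u (n + N)))\<^sup>2) + 2 * (\<Sum>n. (cmod (v (n + N)))\<^sup>2)"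
proof -
  have uN: "summable (\<lambda>n. (cmod (u (n + N)))\<^sup>2)" and vN: "summable (\<lambda>n. (cmod (v (n + N)))\<^sup>2)"
    using u v by (simp_all add: summable_iff_shift[of "\<lambda>n. (cmod (u n))\<^sup>2"] summable_iff_shift[of "\<lambda>n. (cmod (v n))\<^sup>2"])
  have "(\<Sum>n. (cmod (u n - v n))\<^sup>2) = (\<Sum>n. (cmod (u (n + N) - v (n + N)))\<^sup>2) + (\<Sum>n<N. (cmod (u n - v n))\<^sup>2)"
    by (rule suminf_split_initial_segment[OF summable_sq_diff[OF u v]])
  also have "(\<Sum>n. (cmod (u (n + N) - v (n + N)))\<^sup>2) \<le> (\<Sum>n. 2 * (cmod (u (n + N)))\<^sup>2 + 2 * (cmod (v (n + N)))\<^sup>2)"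
    using sq_norm_diff_le summable_sq_diff[OF uN vN] uN vN
    by (intro suminf_le summable_add summable_mult) auto
  also have "\<dots> = 2 * (\<Sum>n. (cmod (u (n + N)))\<^sup>2) + 2 * (\<Sum>n. (cmod (v (n + N)))\<^sup>2)"
    using uN vN by (simp add: suminf_mult summable_mult flip: suminf_add)
  finally show ?thesis by simp
qed

text \<open>
  The map \<open>x \<mapsto> (a\<^sub>n(x))\<^sub>n\<close> is continuous into \<open>l\<^sup>2\<close>: a tail that is small at \<open>p\<close> stays small nearby,
  and only finitely many coordinates remain.
\<close>

lemma l2_continuous:
  fixes a :: "nat \<Rightarrow> 'a::topological_space \<Rightarrow> complex"
  assumes summ: "\<And>x. summable (\<lambda>n. (cmod (a n x))\<^sup>2)"
    and cont: "\<And>n. continuous_on K (a n)"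
    and tail: "\<And>N. continuous_on K (\<lambda>x. \<Sum>n. (cmod (a (n + N) x))\<^sup>2)"
    and "p \<in> K" "0 < e"
  obtains U where "open U" "p \<in> U" "\<And>x. x \<in> K \<Longrightarrow> x \<in> U \<Longrightarrow> (\<Sum>n. (cmod (a n x - a n p))\<^sup>2) < e"
proof -
  have "eventually (\<lambda>N. norm (\<Sum>n. (cmod (a (n + N) p))\<^sup>2) < e / 4) sequentially"
    using suminf_exist_split[OF _ summ[of p], of "e / 4"] \<open>0 < e\<close> by (auto simp: eventually_sequentially)
  then obtain N where "norm (\<Sum>n. (cmod (a (n + N) p))\<^sup>2) < e / 4"
    unfolding eventually_sequentially by blast
  then have N: "(\<Sum>n. (cmod (a (n + N) p))\<^sup>2) < e / 4" by simp
  define h where "h x = (\<Sum>n<N. (cmod (a n x - a n p))\<^sup>2)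
    + 2 * (\<Sum>n. (cmod (a (n + N) x))\<^sup>2) + 2 * (\<Sum>n. (cmod (a (n + N) p))\<^sup>2)" for x
  have "continuous_on K h"
    unfolding h_def by (intro continuous_intros cont tail)
  then obtain U where U: "open U" "U \<inter> K = h -` {..<e} \<inter> K"
    using open_lessThan[of e] unfolding continuous_on_open_invariant by metis
  show ?thesis
  proof
    show "open U" by fact
    have "h p < e" unfolding h_def using N by simp
    then show "p \<in> U" using U \<open>p \<in> K\<close> by auto
    fix x assume "x \<in> K" "x \<in> U"
    then have "h x < e" using U by auto
    then show "(\<Sum>n. (cmod (a n x - a n p))\<^sup>2) < e"
      using suminf_sq_diff_le[OF summ[of x] summ[of p], of N] unfolding h_def by linarith
  qed
qed

lemma l2_pairing_continuous:
  fixes b :: "nat \<Rightarrow> 'a::topological_space \<Rightarrow> complex"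
  assumes c: "summable (\<lambda>n. (cmod (c n))\<^sup>2)"
    and summ: "\<And>x. summable (\<lambda>n. (cmod (b n x))\<^sup>2)"
    and cont: "\<And>n. continuous_on K (b n)"
    and tail: "\<And>N. continuous_on K (\<lambda>x. \<Sum>n. (cmod (b (n + N) x))\<^sup>2)"
  shows "continuous_on K (\<lambda>x. \<Sum>n. c n * b n x)"
  unfolding continuous_on_def tendsto_iff
proof (intro ballI allI impI)
  fix p and e :: real assume p: "p \<in> K" and e: "0 < e"
  define C where "C = (\<Sum>n. (cmod (c n))\<^sup>2)"
  have C0: "0 \<le> C" unfolding C_def using c by (intro suminf_nonneg) auto
  define s where "s = e / (C + 1)"
  have s0: "0 < s" using e C0 by (simp add: s_def)
  have "0 < s * e / 2" using s0 e by simp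
  from l2_continuous[OF summ cont tail p this] obtain U where U: "open U" "p \<in> U"
    "\<And>x. x \<in> K \<Longrightarrow> x \<in> U \<Longrightarrow> (\<Sum>n. (cmod (b n x - b n p))\<^sup>2) < s * e / 2" by blast
  have "dist (\<Sum>n. c n * b n x) (\<Sum>n. c n * b n p) < e" if x: "x \<in> K" "x \<in> U" for x
  proof -
    define d where "d n = b n x - b n p" for n
    have d: "summable (\<lambda>n. (cmod (d n))\<^sup>2)"
      unfolding d_def by (intro summable_sq_diff summ)
    have cb: "summable (\<lambda>n. c n * b n x)" for x
      using summable_mult_of_sq[OF c summ[of x]] by (rule summable_norm_cancel)
    have cd: "summable (\<lambda>n. cmod (c n * d n))"
      using summable_mult_of_sq[OF c d] .
    \<comment> \<open>the weight \<open>s\<close> balances the fixed square sum \<open>C\<close> against the small one of \<open>d\<close>\<close>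
    have weighted: "cmod (c n * d n) \<le> s / 2 * (cmod (c n))\<^sup>2 + 1 / (2 * s) * (cmod (d n))\<^sup>2" for n
    proof -
      have "0 \<le> (s * cmod (c n) - cmod (d n))\<^sup>2 / (2 * s)" using s0 by simp
      also have "\<dots> = s / 2 * (cmod (c n))\<^sup>2 + 1 / (2 * s) * (cmod (d n))\<^sup>2 - cmod (c n * d n)"
        using s0 by (simp add: norm_mult power2_diff field_simps power2_eq_square)
      finally show ?thesis by simp
    qed
    have "(\<Sum>n. c n * b n x) - (\<Sum>n. c n * b n p) = (\<Sum>n. c n * d n)"
      unfolding d_def using suminf_diff[OF cb[of x] cb[of p]] by (simp add: right_diff_distrib)
    then have "dist (\<Sum>n. c n * b n x) (\<Sum>n. c n * b n p) \<le> (\<Sum>n. cmod (c n * d n))"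
      unfolding dist_norm using summable_norm[OF cd] by simp
    also have "\<dots> \<le> (\<Sum>n. s / 2 * (cmod (c n))\<^sup>2 + 1 / (2 * s) * (cmod (d n))\<^sup>2)"
      using c d by (intro suminf_le weighted cd summable_add summable_mult)
    also have "\<dots> = s / 2 * C + 1 / (2 * s) * (\<Sum>n. (cmod (d n))\<^sup>2)"
      unfolding C_def using c d by (simp only: suminf_add[symmetric] suminf_mult summable_mult)
    also have "\<dots> \<le> s / 2 * C + 1 / (2 * s) * (s * e / 2)"
      using U(3)[OF x] s0 unfolding d_def by (intro add_left_mono mult_left_mono) auto
    also have "\<dots> \<le> e / 2 + e / 4"
    proof (rule add_mono)
      show "s / 2 * C \<le> e / 2" using e C0 by (simp add: s_def field_simps)
      show "1 / (2 * s) * (s * e / 2) \<le> e / 4" using s0 by simp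
    qed
    also have "\<dots> < e" using e by simp
    finally show ?thesis .
  qed
  then show "\<forall>\<^sub>F x in at p within K. dist (\<Sum>n. c n * b n x) (\<Sum>n. c n * b n p) < e"
    unfolding eventually_at_topological using U by blast
qed

lemma compact_decreasing_subset_open:
  fixes C :: "nat \<Rightarrow> 'a::t2_space set"
  assumes "\<And>k. compact (C k)" "decseq C" "open W" "(\<Inter>k. C k) \<subseteq> W"
  obtains k where "C k \<subseteq> W"
proof -
  have "C 0 - W \<subseteq> (\<Union>k\<in>UNIV. - C k)" using assms(4) by blast
  moreover have "compact (C 0 - W)" using assms(1,3) by (rule compact_diff)
  ultimately obtain I where I: "finite I" "C 0 - W \<subseteq> (\<Union>k\<in>I. - C k)"
    using compactE_image[of "C 0 - W" UNIV "\<lambda>k. - C k"] assms(1)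
    by (metis compact_imp_closed open_Compl)
  define k where "k = Max (insert 0 I)"
  have "C k \<subseteq> C i" if "i \<in> insert 0 I" for i
    using assms(2) I(1) that by (intro decseqD[OF assms(2)]) (simp add: k_def)
  then have "C k \<subseteq> W" using I(2) by blast
  then show ?thesis by (rule that)
qed

text \<open>
  Coding the set of indices as a natural number makes the cell of a point usable both as an index
  and as a complex-valued function, continuous wherever the indicators of the \<open>F i\<close> are.
\<close>

definition cell :: "nat \<Rightarrow> (nat \<Rightarrow> 'a set) \<Rightarrow> 'a \<Rightarrow> nat" where
  "cell k F x = set_encode {i. i < k \<and> x \<in> F i}"

lemma cell_eq_iff: "cell k F x = cell k G y \<longleftrightarrow> (\<forall>i<k. x \<in> F i \<longleftrightarrow> y \<in> G i)"
  unfolding cell_def by (subst set_encode_eq) auto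

lemma cell_eq_mono: "cell k F x = cell k G y \<Longrightarrow> j \<le> k \<Longrightarrow> cell j F x = cell j G y"
  unfolding cell_eq_iff by simp

lemma of_nat_cell: "of_nat (cell k F x) = (\<Sum>i<k. 2 ^ i * indicator (F i) x :: complex)"
proof -
  have "{i. i < k \<and> x \<in> F i} = {i \<in> {..<k}. x \<in> F i}" by auto
  then have "of_nat (cell k F x) = (\<Sum>i\<in>{i \<in> {..<k}. x \<in> F i}. 2 ^ i :: complex)"
    by (simp add: cell_def set_encode_def)
  also have "\<dots> = (\<Sum>i<k. if x \<in> F i then 2 ^ i else 0)"
    by (rule sum.inter_filter) simp
  also have "\<dots> = (\<Sum>i<k. 2 ^ i * indicator (F i) x)"
    by (intro sum.cong) (auto simp: indicator_def)
  finally show ?thesis .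
qed

lemma cell_clopen:
  fixes K :: "'a::t2_space set"
  assumes "compact K" "\<And>i. continuous_on K (indicator (F i) :: 'a \<Rightarrow> complex)"
  shows "compact {x \<in> K. cell k F x = c}" "\<exists>U. open U \<and> {x \<in> K. cell k F x = c} = K \<inter> U"
proof -
  let ?h = "\<lambda>x. of_nat (cell k F x) :: complex"
  have h: "continuous_on K ?h"
    unfolding of_nat_cell using assms(2) by (intro continuous_intros) simp
  have "closed (K \<inter> ?h -` {of_nat c})"
    using h compact_imp_closed[OF assms(1)] by (rule continuous_closed_preimage) simp
  moreover have "K \<inter> ?h -` {of_nat c} = {x \<in> K. cell k F x = c}" by auto
  moreover have "K \<inter> (K \<inter> ?h -` {of_nat c}) = K \<inter> ?h -` {of_nat c}" by blast
  ultimately show "compact {x \<in> K. cell k F x = c}"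
    using compact_Int_closed[OF assms(1), of "K \<inter> ?h -` {of_nat c}"] by simp
  obtain U where U: "open U" "U \<inter> K = ?h -` ball (of_nat c) 1 \<inter> K"
    using h[unfolded continuous_on_open_invariant, rule_format, OF open_ball, of "of_nat c" 1] by metis
  have "dist (of_nat c) (of_nat j :: complex) < 1 \<longleftrightarrow> j = c" for j
  proof -
    have "dist (of_nat c) (of_nat j :: complex) = cmod (of_real (real c - real j))"
      by (simp add: dist_norm)
    also have "\<dots> = \<bar>real c - real j\<bar>" by (rule norm_of_real)
    finally have "dist (of_nat c) (of_nat j :: complex) = \<bar>real c - real j\<bar>" .
    then show ?thesis by linarith
  qed
  then have "?h x \<in> ball (of_nat c) 1 \<longleftrightarrow> cell k F x = c" for x by simp
  moreover have "?h x \<in> ball (of_nat c) 1 \<longleftrightarrow> x \<in> U" if "x \<in> K" for x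
    using U(2) that by blast
  ultimately have "{x \<in> K. cell k F x = c} = K \<inter> U" by blast
  with U(1) show "\<exists>U. open U \<and> {x \<in> K. cell k F x = c} = K \<inter> U" by blast
qed

text \<open>
  Every point of \<open>X\<close> has one of finitely many points \<open>p i\<close> within \<open>l\<^sup>2\<close> distance \<open>d\<close> of its
  coefficients, while \<open>w = \<Sum>\<^sub>n a\<^sub>n \<otimes> b\<^sub>n\<close> almost vanishes on each \<open>{p i} \<times> Y\<close>. The values there enter
  as a square sum over \<open>i\<close>, because there is no control on the number \<open>r\<close> of the points.
\<close>

definition negligible_rectangle ::
    "(nat \<Rightarrow> 'a \<Rightarrow> complex) \<Rightarrow> (nat \<Rightarrow> 'a \<Rightarrow> complex) \<Rightarrow> real \<Rightarrow> 'a set \<Rightarrow> 'a set \<Rightarrow> bool" where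
  "negligible_rectangle a b d X Y \<longleftrightarrow> (\<exists>(r::nat) p.
     (\<forall>x\<in>X. \<exists>i<r. (\<Sum>n. (cmod (a n x - a n (p i)))\<^sup>2) \<le> d\<^sup>2) \<and>
     (\<forall>y\<in>Y. (\<Sum>i<r. (cmod (\<Sum>n. a n (p i) * b n y))\<^sup>2) \<le> d\<^sup>2))"

lemma negligible_rectangle_mono:
  "negligible_rectangle a b d X Y \<Longrightarrow> X' \<subseteq> X \<Longrightarrow> Y' \<subseteq> Y \<Longrightarrow> negligible_rectangle a b d X' Y'"
  unfolding negligible_rectangle_def by (elim ex_forward) blast

lemma negligible_rectangle_empty: "negligible_rectangle a b d {} Y"
  unfolding negligible_rectangle_def by (intro exI[of _ 0]) simp

text \<open>
  On the limit cell \<open>\<Inter>k. {x' \<in> K. cell k F x' = cell k F x}\<close> a finite net exists by compactness, and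
  \<open>w\<close> vanishes exactly between its points and the corresponding limit cell of \<open>L\<close>. Both properties
  are open, so they persist on the cells of some finite level.
\<close>

lemma negligible_cells_at:
  fixes a b :: "nat \<Rightarrow> 'a::t2_space \<Rightarrow> complex"
  assumes a: "\<And>x. summable (\<lambda>n. (cmod (a n x))\<^sup>2)" and b: "\<And>y. summable (\<lambda>n. (cmod (b n y))\<^sup>2)"
    and KL: "compact K" "compact L"
    and a_cont: "\<And>n. continuous_on K (a n)" "\<And>N. continuous_on K (\<lambda>x. \<Sum>n. (cmod (a (n + N) x))\<^sup>2)"
    and b_cont: "\<And>n. continuous_on L (b n)" "\<And>N. continuous_on L (\<lambda>x. \<Sum>n. (cmod (b (n + N) x))\<^sup>2)"
    and F: "\<And>i. continuous_on K (indicator (F i) :: 'a \<Rightarrow> complex)"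
    and G: "\<And>i. continuous_on L (indicator (G i) :: 'a \<Rightarrow> complex)"
    and zero: "\<And>x y. (\<And>i. x \<in> F i \<longleftrightarrow> y \<in> G i) \<Longrightarrow> (\<Sum>n. a n x * b n y) = 0"
    and d: "0 < d" and x: "x \<in> K"
  obtains k where "negligible_rectangle a b d {x' \<in> K. cell k F x' = cell k F x} {y \<in> L. cell k G y = cell k F x}"
proof -
  define Kx where "Kx k = {x' \<in> K. cell k F x' = cell k F x}" for k
  define Lx where "Lx k = {y \<in> L. cell k G y = cell k F x}" for k
  have comp: "compact (Kx k)" "compact (Lx k)" for k
    unfolding Kx_def Lx_def using cell_clopen(1) KL F G by blast+
  have dec: "decseq Kx" "decseq Lx"
    unfolding decseq_def Kx_def Lx_def by (auto dest: cell_eq_mono)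
  have "\<exists>U. open U \<and> p \<in> U \<and> (\<forall>x\<in>K \<inter> U. (\<Sum>n. (cmod (a n x - a n p))\<^sup>2) \<le> d\<^sup>2)" if p: "p \<in> K" for p
  proof -
    have "0 < d\<^sup>2" using d by simp
    from l2_continuous[OF a a_cont p this] obtain U where "open U" "p \<in> U"
      "\<And>x. x \<in> K \<Longrightarrow> x \<in> U \<Longrightarrow> (\<Sum>n. (cmod (a n x - a n p))\<^sup>2) < d\<^sup>2" by blast
    then show ?thesis by (intro exI[of _ U]) (auto intro: less_imp_le)
  qed
  then obtain U where U: "\<And>p. p \<in> K \<Longrightarrow> open (U p)" "\<And>p. p \<in> K \<Longrightarrow> p \<in> U p"
      "\<And>p x. p \<in> K \<Longrightarrow> x \<in> K \<Longrightarrow> x \<in> U p \<Longrightarrow> (\<Sum>n. (cmod (a n x - a n p))\<^sup>2) \<le> d\<^sup>2"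
    by (metis IntI)
  define Kinf where "Kinf = (\<Inter>k. Kx k)"
  have KinfK: "Kinf \<subseteq> K" by (auto simp: Kinf_def Kx_def)
  have "closed Kinf"
    unfolding Kinf_def by (intro closed_INT ballI compact_imp_closed comp)
  then have "compact Kinf"
    using compact_Int_closed[OF KL(1)] KinfK by (metis inf.absorb2)
  moreover have "Kinf \<subseteq> (\<Union>p\<in>Kinf. U p)" using U(2) KinfK by blast
  ultimately obtain I where I: "I \<subseteq> Kinf" "finite I" "Kinf \<subseteq> (\<Union>p\<in>I. U p)"
    using compactE_image[of Kinf Kinf U] U(1) KinfK by (metis subsetD)
  obtain r :: nat and p where p: "I = p ` {i. i < r}"
    using finite_imp_nat_seg_image_inj_on[OF I(2)] by metis
  have "open (\<Union>p\<in>I. U p)" using U(1) I(1) KinfK by blast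
  from compact_decreasing_subset_open[OF comp(1) dec(1) this I(3)[unfolded Kinf_def]]
  obtain k1 where k1: "Kx k1 \<subseteq> (\<Union>p\<in>I. U p)" .
  define h where "h y = (\<Sum>i<r. (cmod (\<Sum>n. a n (p i) * b n y))\<^sup>2)" for y
  have "continuous_on L h"
    unfolding h_def by (intro continuous_intros l2_pairing_continuous a b b_cont)
  then obtain W where W: "open W" "W \<inter> L = h -` {..<d\<^sup>2} \<inter> L"
    using open_lessThan[of "d\<^sup>2"] unfolding continuous_on_open_invariant by metis
  have "(\<Inter>k. Lx k) \<subseteq> W"
  proof
    fix y assume y: "y \<in> (\<Inter>k. Lx k)"
    have "(\<Sum>n. a n (p i) * b n y) = 0" if "i < r" for i
    proof (rule zero)
      fix j
      have "p i \<in> Kinf" using that p I(1) by auto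
      then have "cell (Suc j) F (p i) = cell (Suc j) G y"
        using y by (auto simp: Kinf_def Kx_def Lx_def)
      then show "p i \<in> F j \<longleftrightarrow> y \<in> G j" unfolding cell_eq_iff by blast
    qed
    then have "h y = 0" by (simp add: h_def)
    moreover have "y \<in> L" using y by (simp add: Lx_def)
    ultimately show "y \<in> W" using W(2) d by auto
  qed
  from compact_decreasing_subset_open[OF comp(2) dec(2) W(1) this]
  obtain k2 where k2: "Lx k2 \<subseteq> W" .
  define k where "k = max k1 k2"
  have sub: "Kx k \<subseteq> Kx k1" "Lx k \<subseteq> Lx k2"
    using dec by (auto simp: k_def decseq_def)
  have "negligible_rectangle a b d (Kx k) (Lx k)"
    unfolding negligible_rectangle_def
  proof (rule exI[of _ r], rule exI[of _ p], intro conjI ballI)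
    fix x' assume x': "x' \<in> Kx k"
    then obtain i where i: "i < r" "x' \<in> U (p i)" using sub(1) k1 p by auto
    moreover have "p i \<in> K" using i(1) p I(1) KinfK by auto
    moreover have "x' \<in> K" using x' by (simp add: Kx_def)
    ultimately show "\<exists>i<r. (\<Sum>n. (cmod (a n x' - a n (p i)))\<^sup>2) \<le> d\<^sup>2" using U(3) by blast
  next
    fix y assume y: "y \<in> Lx k"
    then have "y \<in> W \<inter> L" using sub(2) k2 by (auto simp: Lx_def)
    then have "h y < d\<^sup>2" unfolding W(2) by simp
    then show "(\<Sum>i<r. (cmod (\<Sum>n. a n (p i) * b n y))\<^sup>2) \<le> d\<^sup>2" by (simp add: h_def)
  qed
  then show ?thesis unfolding Kx_def Lx_def by (rule that)
qed

text \<open>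
  The level needed at a point of \<open>K\<close> works on its whole cell, which is relatively open, and a
  rectangle inside a negligible one is negligible. Hence finitely many levels suffice.
\<close>

lemma negligible_cells:
  fixes a b :: "nat \<Rightarrow> 'a::t2_space \<Rightarrow> complex"
  assumes a: "\<And>x. summable (\<lambda>n. (cmod (a n x))\<^sup>2)" and b: "\<And>y. summable (\<lambda>n. (cmod (b n y))\<^sup>2)"
    and KL: "compact K" "compact L"
    and a_cont: "\<And>n. continuous_on K (a n)" "\<And>N. continuous_on K (\<lambda>x. \<Sum>n. (cmod (a (n + N) x))\<^sup>2)"
    and b_cont: "\<And>n. continuous_on L (b n)" "\<And>N. continuous_on L (\<lambda>x. \<Sum>n. (cmod (b (n + N) x))\<^sup>2)"
    and F: "\<And>i. continuous_on K (indicator (F i) :: 'a \<Rightarrow> complex)"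
    and G: "\<And>i. continuous_on L (indicator (G i) :: 'a \<Rightarrow> complex)"
    and zero: "\<And>x y. (\<And>i. x \<in> F i \<longleftrightarrow> y \<in> G i) \<Longrightarrow> (\<Sum>n. a n x * b n y) = 0"
    and d: "0 < d"
  obtains k0 where "\<And>k c. k0 \<le> k \<Longrightarrow>
    negligible_rectangle a b d {x \<in> K. cell k F x = c} {y \<in> L. cell k G y = c}"
proof -
  have "\<exists>k. negligible_rectangle a b d {x' \<in> K. cell k F x' = cell k F x} {y \<in> L. cell k G y = cell k F x}"
    if "x \<in> K" for x
    by (rule negligible_cells_at[OF a b KL a_cont b_cont F G zero d that]) (assumption, rule exI)
  then have "\<exists>\<kappa>. \<forall>x\<in>K. negligible_rectangle a b d
      {x' \<in> K. cell (\<kappa> x) F x' = cell (\<kappa> x) F x} {y \<in> L. cell (\<kappa> x) G y = cell (\<kappa> x) F x}"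
    by (intro bchoice ballI)
  then obtain \<kappa> where \<kappa>: "\<And>x. x \<in> K \<Longrightarrow> negligible_rectangle a b d
      {x' \<in> K. cell (\<kappa> x) F x' = cell (\<kappa> x) F x} {y \<in> L. cell (\<kappa> x) G y = cell (\<kappa> x) F x}"
    by blast
  have "\<forall>x. \<exists>U. open U \<and> {x' \<in> K. cell (\<kappa> x) F x' = cell (\<kappa> x) F x} = K \<inter> U"
    by (intro allI cell_clopen(2)[OF KL(1) F])
  then obtain U where U: "\<And>x. open (U x)"
      "\<And>x. {x' \<in> K. cell (\<kappa> x) F x' = cell (\<kappa> x) F x} = K \<inter> U x"
    by metis
  have "K \<subseteq> (\<Union>x\<in>K. U x)" using U(2) by blast
  then obtain I where I: "I \<subseteq> K" "finite I" "K \<subseteq> (\<Union>x\<in>I. U x)"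
    using compactE_image[OF KL(1), of K U] U(1) by metis
  define k0 where "k0 = Max (insert 0 (\<kappa> ` I))"
  have k0: "\<kappa> x \<le> k0" if "x \<in> I" for x
    using that I(2) by (simp add: k0_def)
  show ?thesis
  proof (rule that[of k0])
    fix k c assume k: "k0 \<le> k"
    show "negligible_rectangle a b d {x \<in> K. cell k F x = c} {y \<in> L. cell k G y = c}"
    proof (cases "{x \<in> K. cell k F x = c} = {}")
      case True
      then show ?thesis by (simp only: negligible_rectangle_empty)
    next
      case False
      then obtain x' where x': "x' \<in> K" "cell k F x' = c" by blast
      then obtain x where x: "x \<in> I" "x' \<in> U x" using I(3) by blast
      have le: "\<kappa> x \<le> k" using k0[OF x(1)] k by simp
      have eq: "cell (\<kappa> x) F x' = cell (\<kappa> x) F x" using U(2)[of x] x'(1) x(2) by blast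
      have "{x \<in> K. cell k F x = c} \<subseteq> {x' \<in> K. cell (\<kappa> x) F x' = cell (\<kappa> x) F x}"
        "{y \<in> L. cell k G y = c} \<subseteq> {y \<in> L. cell (\<kappa> x) G y = cell (\<kappa> x) F x}"
        using cell_eq_mono[OF _ le, where y = x' and G = F] x'(2) eq by auto
      then show ?thesis
        using negligible_rectangle_mono[OF \<kappa>] x(1) I(1) by blast
    qed
  qed
qed

section \<open>Norm estimates on rectangles\<close>

lemma rho_indicator: "rho (\<lambda>n x. indicator X x * a n x) = (\<lambda>x. rho a x * indicator X x)"
  by (auto simp: rho_def fun_eq_iff indicator_def)

lemma T_norm_rectangle_le:
  assumes meas: "\<And>n. a n \<in> borel_measurable m" "\<And>n. b n \<in> borel_measurable m"
    and fin: "(\<integral>\<^sup>+x. rho a x \<partial>m) < \<infinity>" "(\<integral>\<^sup>+x. rho b x \<partial>m) < \<infinity>"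
    and w: "mae m (\<lambda>(x, y). (\<lambda>n. a n x * b n y) sums w (x, y))"
    and XY: "X \<in> sets m" "Y \<in> sets m" and "0 < e"
  shows "T_norm m (\<lambda>(x, y). indicator X x * indicator Y y * w (x, y))
    \<le> ennreal (1 / e) * emeasure (density m (rho a)) X + ennreal e * emeasure (density m (rho b)) Y"
proof -
  note [measurable] = meas XY
  have "T_norm m (\<lambda>(x, y). indicator X x * indicator Y y * w (x, y))
      \<le> ennreal (1 / e) * (\<integral>\<^sup>+x. rho (\<lambda>n x. indicator X x * a n x) x \<partial>m)
        + ennreal e * (\<integral>\<^sup>+x. rho (\<lambda>n x. indicator Y x * b n x) x \<partial>m)"
  proof (rule T_norm_le_rho)
    have "(\<integral>\<^sup>+x. rho a x * indicator X x \<partial>m) \<le> (\<integral>\<^sup>+x. rho a x \<partial>m)"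
      "(\<integral>\<^sup>+x. rho b x * indicator Y x \<partial>m) \<le> (\<integral>\<^sup>+x. rho b x \<partial>m)"
      by (intro nn_integral_mono; simp add: indicator_def)+
    then show "(\<integral>\<^sup>+x. rho (\<lambda>n x. indicator X x * a n x) x \<partial>m) < \<infinity>"
      "(\<integral>\<^sup>+x. rho (\<lambda>n x. indicator Y x * b n x) x \<partial>m) < \<infinity>"
      unfolding rho_indicator using fin by (auto intro: le_less_trans)
    show "mae m (\<lambda>(x, y). (\<lambda>n. indicator X x * a n x * (indicator Y y * b n y)) sums
        (case (x, y) of (x, y) \<Rightarrow> indicator X x * indicator Y y * w (x, y)))"
    proof (rule mae_mono[OF w])
      fix x y assume "case (x, y) of (x, y) \<Rightarrow> (\<lambda>n. a n x * b n y) sums w (x, y)"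
      then have "(\<lambda>n. indicator X x * indicator Y y * (a n x * b n y)) sums
          (indicator X x * indicator Y y * w (x, y))"
        by (intro sums_mult) simp
      then show "case (x, y) of (x, y) \<Rightarrow> (\<lambda>n. indicator X x * a n x * (indicator Y y * b n y)) sums
          (case (x, y) of (x, y) \<Rightarrow> indicator X x * indicator Y y * w (x, y))"
        by (simp add: ac_simps)
    qed
  qed (use \<open>0 < e\<close> in measurable)
  then show ?thesis
    unfolding rho_indicator by (simp add: emeasure_density)
qed

text \<open>
  Replacing \<open>a n x\<close> by its value at the first point of the net that is \<open>d\<close>-close to \<open>x\<close> costs \<open>d\<close> in
  \<open>l\<^sup>2\<close>. What remains is a sum of finitely many elementary tensors, the indicator of the part of \<open>X\<close>
  served by \<open>p i\<close> times the section of \<open>w\<close> at \<open>p i\<close>; since those parts are disjoint, only the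
  square sum of the sections enters.
\<close>

lemma T_norm_negligible_rectangle:
  fixes a b :: "nat \<Rightarrow> 'a \<Rightarrow> complex"
  assumes meas: "\<And>n. a n \<in> borel_measurable m" "\<And>n. b n \<in> borel_measurable m"
    and fin: "(\<integral>\<^sup>+x. rho b x \<partial>m) < \<infinity>"
    and a: "\<And>x. summable (\<lambda>n. (cmod (a n x))\<^sup>2)" and b: "\<And>y. summable (\<lambda>n. (cmod (b n y))\<^sup>2)"
    and w: "mae m (\<lambda>(x, y). (\<lambda>n. a n x * b n y) sums w (x, y))"
    and XY: "X \<in> sets m" "Y \<in> sets m" "emeasure m X < \<infinity>" "emeasure m Y < \<infinity>"
    and neg: "negligible_rectangle a b d X Y" and "0 < d"
  shows "T_norm m (\<lambda>(x, y). indicator X x * indicator Y y * w (x, y))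
    \<le> ennreal d * (2 * emeasure m X + emeasure m Y + emeasure (density m (rho b)) Y)"
proof -
  note [measurable] = meas XY(1,2)
  obtain r :: nat and p where p: "\<And>x. x \<in> X \<Longrightarrow> \<exists>i<r. (\<Sum>n. (cmod (a n x - a n (p i)))\<^sup>2) \<le> d\<^sup>2"
      "\<And>y. y \<in> Y \<Longrightarrow> (\<Sum>i<r. (cmod (\<Sum>n. a n (p i) * b n y))\<^sup>2) \<le> d\<^sup>2"
    using neg unfolding negligible_rectangle_def by auto
  \<comment> \<open>the index of the net point that replaces \<open>x\<close>; taking the least one makes it measurable\<close>
  define \<iota> where "\<iota> x = (LEAST i. (\<Sum>n. (cmod (a n x - a n (p i)))\<^sup>2) \<le> d\<^sup>2)" for x
  have \<iota>: "\<iota> x < r" "(\<Sum>n. (cmod (a n x - a n (p (\<iota> x))))\<^sup>2) \<le> d\<^sup>2" if x: "x \<in> X" for x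
  proof -
    obtain i where i: "i < r" "(\<Sum>n. (cmod (a n x - a n (p i)))\<^sup>2) \<le> d\<^sup>2" using p(1)[OF x] by blast
    show "(\<Sum>n. (cmod (a n x - a n (p (\<iota> x))))\<^sup>2) \<le> d\<^sup>2"
      unfolding \<iota>_def using i(2) by (rule LeastI)
    have "\<iota> x \<le> i" unfolding \<iota>_def using i(2) by (rule Least_le)
    then show "\<iota> x < r" using i(1) by simp
  qed
  have [measurable]: "\<iota> \<in> measurable m (count_space UNIV)"
    unfolding \<iota>_def by measurable
  define h where "h i y = (\<Sum>n. a n (p i) * b n y)" for i y
  have [measurable]: "h i \<in> borel_measurable m" for i
    unfolding h_def by measurable
  have [measurable]: "(\<lambda>x. a n (p (\<iota> x))) \<in> borel_measurable m" for n
    by (rule measurable_compose[OF \<open>\<iota> \<in> measurable m (count_space UNIV)\<close>]) simp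
  define a1 where "a1 n x = indicator X x * (a n x - a n (p (\<iota> x)))" for n x
  define b1 where "b1 n y = indicator Y y * b n y" for n y
  define a2 :: "nat \<Rightarrow> 'a \<Rightarrow> complex" where "a2 n x = (if n = \<iota> x then indicator X x else 0)" for n x
  define b2 where "b2 n y = (if n < r then indicator Y y * h n y else 0)" for n y
  have [measurable]: "a1 n \<in> borel_measurable m" "b1 n \<in> borel_measurable m"
      "a2 n \<in> borel_measurable m" "b2 n \<in> borel_measurable m" for n
    unfolding a1_def b1_def a2_def b2_def by measurable
  define u1 where "u1 = (\<lambda>(x, y). \<Sum>n. a1 n x * b1 n y)"
  define u2 where "u2 = (\<lambda>(x, y). indicator X x * indicator Y y * h (\<iota> x) y)"

  have rho_a1: "rho a1 x \<le> ennreal (d\<^sup>2) * indicator X x" for x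
  proof (cases "x \<in> X")
    case True
    have "rho a1 x = (\<Sum>n. ennreal ((cmod (a n x - a n (p (\<iota> x))))\<^sup>2))"
      using True by (simp add: rho_def a1_def)
    also have "\<dots> = ennreal (\<Sum>n. (cmod (a n x - a n (p (\<iota> x))))\<^sup>2)"
      using summable_sq_diff[OF a a] by (intro suminf_ennreal_eq summable_sums) auto
    also have "\<dots> \<le> ennreal (d\<^sup>2)" using \<iota>(2)[OF True] by (rule ennreal_leI)
    finally show ?thesis using True by simp
  qed (simp add: rho_def a1_def)
  have rho_a2: "rho a2 x = indicator X x" for x
  proof -
    have "(\<lambda>n. (cmod (a2 n x))\<^sup>2) sums (\<Sum>n\<in>{\<iota> x}. (cmod (a2 n x))\<^sup>2)"
      by (rule sums_finite) (auto simp: a2_def)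
    then have "rho a2 x = ennreal (\<Sum>n\<in>{\<iota> x}. (cmod (a2 n x))\<^sup>2)"
      unfolding rho_def by (intro suminf_ennreal_eq) auto
    then show ?thesis by (simp add: a2_def indicator_def)
  qed
  have rho_b2: "rho b2 y \<le> ennreal (d\<^sup>2) * indicator Y y" for y
  proof (cases "y \<in> Y")
    case True
    have "(\<lambda>n. (cmod (b2 n y))\<^sup>2) sums (\<Sum>n<r. (cmod (b2 n y))\<^sup>2)"
      by (rule sums_finite) (auto simp: b2_def)
    then have "rho b2 y = ennreal (\<Sum>n<r. (cmod (b2 n y))\<^sup>2)"
      unfolding rho_def by (intro suminf_ennreal_eq) auto
    also have "\<dots> = ennreal (\<Sum>n<r. (cmod (\<Sum>k. a k (p n) * b k y))\<^sup>2)"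
      using True by (simp add: b2_def h_def)
    also have "\<dots> \<le> ennreal (d\<^sup>2)" using p(2)[OF True] by (rule ennreal_leI)
    finally show ?thesis using True by simp
  next
    case False
    then have "b2 n y = 0" for n by (simp add: b2_def)
    then show ?thesis by (simp add: rho_def)
  qed
  have int_a1: "(\<integral>\<^sup>+x. rho a1 x \<partial>m) \<le> ennreal (d\<^sup>2) * emeasure m X"
    using nn_integral_mono[of m "rho a1", OF rho_a1] by (simp add: nn_integral_cmult_indicator)
  have int_b1: "(\<integral>\<^sup>+y. rho b1 y \<partial>m) = emeasure (density m (rho b)) Y"
    unfolding b1_def rho_indicator by (simp add: emeasure_density)
  have int_a2: "(\<integral>\<^sup>+x. rho a2 x \<partial>m) = emeasure m X"
    unfolding rho_a2 by simp
  have int_b2: "(\<integral>\<^sup>+y. rho b2 y \<partial>m) \<le> ennreal (d\<^sup>2) * emeasure m Y"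
    using nn_integral_mono[of m "rho b2", OF rho_b2] by (simp add: nn_integral_cmult_indicator)
  have int_b1_fin: "(\<integral>\<^sup>+y. rho b1 y \<partial>m) < \<infinity>"
  proof -
    have "rho b1 y \<le> rho b y" for y
      unfolding b1_def rho_indicator by (simp add: indicator_def)
    then have "(\<integral>\<^sup>+y. rho b1 y \<partial>m) \<le> (\<integral>\<^sup>+y. rho b y \<partial>m)" by (intro nn_integral_mono)
    then show ?thesis using fin by (rule le_less_trans)
  qed
  have fin_d2: "ennreal (d\<^sup>2) * emeasure m X < \<infinity>" "ennreal (d\<^sup>2) * emeasure m Y < \<infinity>"
    using XY(3,4) by (simp_all add: ennreal_mult_less_top)

  have split: "indicator X x * indicator Y y * w (x, y) = u1 (x, y) + u2 (x, y)"
    if w: "(\<lambda>n. a n x * b n y) sums w (x, y)" for x y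
  proof -
    have s: "summable (\<lambda>n. a n (p (\<iota> x)) * b n y)"
      using summable_mult_of_sq[OF a b] by (rule summable_norm_cancel)
    have "(\<lambda>n. indicator X x * indicator Y y * (a n x * b n y - a n (p (\<iota> x)) * b n y)) sums
        (indicator X x * indicator Y y * (w (x, y) - h (\<iota> x) y))"
      unfolding h_def by (intro sums_mult sums_diff w summable_sums s)
    moreover have "(\<lambda>n. indicator X x * indicator Y y * (a n x * b n y - a n (p (\<iota> x)) * b n y))
        = (\<lambda>n. a1 n x * b1 n y)"
      by (simp add: a1_def b1_def algebra_simps fun_eq_iff)
    ultimately have "u1 (x, y) = indicator X x * indicator Y y * (w (x, y) - h (\<iota> x) y)"
      unfolding u1_def by (simp add: sums_iff)
    then show ?thesis by (simp add: u2_def algebra_simps)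
  qed
  have "T_norm m (\<lambda>(x, y). indicator X x * indicator Y y * w (x, y)) = T_norm m (\<lambda>p. u1 p + u2 p)"
    by (intro T_norm_cong_mae mae_mono[OF w]) (use split in auto)
  also have "\<dots> \<le> T_norm m u1 + T_norm m u2"
    by (rule T_norm_add)
  also have "T_norm m u1 \<le> ennreal (1 / d) * (\<integral>\<^sup>+x. rho a1 x \<partial>m) + ennreal d * (\<integral>\<^sup>+y. rho b1 y \<partial>m)"
  proof (rule T_norm_le_rho)
    show "(\<integral>\<^sup>+x. rho a1 x \<partial>m) < \<infinity>" using int_a1 fin_d2(1) by (rule le_less_trans)
    show "mae m (\<lambda>(x, y). (\<lambda>n. a1 n x * b1 n y) sums u1 (x, y))"
    proof (rule mae_everywhere, simp)
      fix x y
      have "summable (\<lambda>n. (cmod (a1 n x))\<^sup>2)" "summable (\<lambda>n. (cmod (b1 n y))\<^sup>2)"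
        unfolding a1_def b1_def using summable_sq_diff[OF a a] b by (simp_all add: indicator_def)
      then show "(\<lambda>n. a1 n x * b1 n y) sums u1 (x, y)"
        unfolding u1_def prod.case
        by (intro summable_sums summable_norm_cancel[OF summable_mult_of_sq])
    qed
    show "(\<integral>\<^sup>+y. rho b1 y \<partial>m) < \<infinity>" by (rule int_b1_fin)
    show "0 < d" by fact
  qed measurable
  also have "ennreal (1 / d) * (\<integral>\<^sup>+x. rho a1 x \<partial>m) \<le> ennreal (1 / d) * (ennreal (d\<^sup>2) * emeasure m X)"
    by (intro mult_left_mono int_a1) simp
  also have "\<dots> = ennreal d * emeasure m X"
    using \<open>0 < d\<close> by (simp add: power2_eq_square flip: mult.assoc ennreal_mult)
  \<comment> \<open>weight \<open>1 / d\<close> in place of \<open>d\<close>: now the second factor is the one of order \<open>d\<^sup>2\<close>\<close>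
  also have "T_norm m u2 \<le> ennreal (1 / (1 / d)) * (\<integral>\<^sup>+x. rho a2 x \<partial>m) + ennreal (1 / d) * (\<integral>\<^sup>+y. rho b2 y \<partial>m)"
  proof (rule T_norm_le_rho)
    show "(\<integral>\<^sup>+y. rho b2 y \<partial>m) < \<infinity>" using int_b2 fin_d2(2) by (rule le_less_trans)
    show "(\<integral>\<^sup>+x. rho a2 x \<partial>m) < \<infinity>" unfolding int_a2 by (rule XY)
    show "mae m (\<lambda>(x, y). (\<lambda>n. a2 n x * b2 n y) sums u2 (x, y))"
    proof (rule mae_everywhere, simp)
      fix x y
      have "(\<lambda>n. a2 n x * b2 n y) sums (\<Sum>n\<in>{\<iota> x}. a2 n x * b2 n y)"
        by (rule sums_finite) (auto simp: a2_def)
      also have "(\<Sum>n\<in>{\<iota> x}. a2 n x * b2 n y) = a2 (\<iota> x) x * b2 (\<iota> x) y"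
        by simp
      also have "\<dots> = u2 (x, y)"
        using \<iota>(1)[of x] by (cases "x \<in> X") (simp_all add: a2_def b2_def u2_def)
      finally show "(\<lambda>n. a2 n x * b2 n y) sums u2 (x, y)" .
    qed
    show "0 < 1 / d" using \<open>0 < d\<close> by simp
  qed measurable
  also have "ennreal (1 / d) * (\<integral>\<^sup>+y. rho b2 y \<partial>m) \<le> ennreal (1 / d) * (ennreal (d\<^sup>2) * emeasure m Y)"
    by (intro mult_left_mono int_b2) simp
  also have "\<dots> = ennreal d * emeasure m Y"
    using \<open>0 < d\<close> by (simp add: power2_eq_square flip: mult.assoc ennreal_mult)
  finally have "T_norm m (\<lambda>(x, y). indicator X x * indicator Y y * w (x, y)) \<le>
      ennreal d * emeasure m X + ennreal d * emeasure (density m (rho b)) Y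
        + (ennreal d * emeasure m X + ennreal d * emeasure m Y)"
    unfolding int_b1 int_a2 by (simp add: add_mono)
  also have "\<dots> = ennreal d * (2 * emeasure m X + emeasure m Y + emeasure (density m (rho b)) Y)"
    by (simp add: algebra_simps mult_2)
  finally show ?thesis .
qed

section \<open>Truncation to the cells of a finite level\<close>

lemma finite_range_cell: "finite (range (cell k F))"
proof (rule finite_subset)
  show "range (cell k F) \<subseteq> set_encode ` Pow {..<k}"
    by (auto simp: cell_def)
qed simp

lemma measurable_cell:
  assumes "\<And>i. F i \<in> sets m"
  shows "{x \<in> space m. cell k F x = c} \<in> sets m"
proof (cases "\<exists>x. cell k F x = c")
  case True
  then obtain x0 where x0: "cell k F x0 = c" by blast
  have [measurable]: "\<And>i. F i \<in> sets m" by (rule assms)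
  have "{x \<in> space m. cell k F x = c} = {x \<in> space m. \<forall>i\<in>{..<k}. x \<in> F i \<longleftrightarrow> x0 \<in> F i}"
    unfolding x0[symmetric] cell_eq_iff by auto
  also have "\<dots> \<in> sets m" by measurable
  finally show ?thesis .
qed simp

lemma sum_emeasure_partition:
  assumes "finite I" "\<And>c. c \<in> I \<Longrightarrow> A c \<in> sets M" "T \<in> sets M" "T \<subseteq> (\<Union>c\<in>I. A c)"
    "disjoint_family_on A I"
  shows "(\<Sum>c\<in>I. emeasure M (T \<inter> A c)) = emeasure M T"
  by (rule sum_emeasure_cover[symmetric]) (use assms in auto)

lemma ennreal_scale_below:
  assumes "(C::ennreal) < \<infinity>" "0 < (\<epsilon>::real)"
  obtains e :: real where "0 < e" "ennreal e * C \<le> ennreal \<epsilon>"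
proof -
  obtain c where c: "0 \<le> c" "C = ennreal c"
    using assms(1) by (cases C) auto
  show ?thesis
  proof (rule that[of "\<epsilon> / (c + 1)"])
    show "0 < \<epsilon> / (c + 1)" using c assms(2) by simp
    show "ennreal (\<epsilon> / (c + 1)) * C \<le> ennreal \<epsilon>"
      using c assms(2) by (simp add: field_simps flip: ennreal_mult)
  qed
qed

context outer_regular_measure
begin

text \<open>
  Each product of cells is split along \<open>K\<close> and \<open>L\<close>: outside, one of the two factors carries little
  mass; inside, the rectangle is negligible. Every term of the bound is a measure of a cell, so the
  terms add up over the disjoint cells.
\<close>

lemma T_norm_cells_le:
  fixes a b :: "nat \<Rightarrow> 'a \<Rightarrow> complex"
  assumes meas: "\<And>n. a n \<in> borel_measurable m" "\<And>n. b n \<in> borel_measurable m"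
    and fin: "(\<integral>\<^sup>+x. rho a x \<partial>m) < \<infinity>" "(\<integral>\<^sup>+x. rho b x \<partial>m) < \<infinity>"
    and a: "\<And>x. summable (\<lambda>n. (cmod (a n x))\<^sup>2)" and b: "\<And>y. summable (\<lambda>n. (cmod (b n y))\<^sup>2)"
    and w: "mae m (\<lambda>(x, y). (\<lambda>n. a n x * b n y) sums w (x, y))"
    and FG: "\<And>i. F i \<in> sets m" "\<And>i. G i \<in> sets m"
    and KL: "compact K" "compact L"
    and neg: "\<And>c. negligible_rectangle a b d {x \<in> K. cell k F x = c} {y \<in> L. cell k G y = c}"
    and "0 < d" "0 < e"
  shows "T_norm m (\<lambda>(x, y). if cell k F x = cell k G y then w (x, y) else 0)
    \<le> ennreal (1 / e) * emeasure (density m (rho a)) (- K) + ennreal e * emeasure (density m (rho b)) UNIV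
      + (ennreal e * emeasure (density m (rho a)) UNIV + ennreal (1 / e) * emeasure (density m (rho b)) (- L))
      + ennreal d * (2 * emeasure m K + emeasure m L + emeasure (density m (rho b)) UNIV)"
proof -
  define I where "I = range (cell k F)"
  define X where "X c = {x. cell k F x = c}" for c
  define Y where "Y c = {y. cell k G y = c}" for c
  define P where "P = density m (rho a)"
  define Q where "Q = density m (rho b)"
  have sets_PQ [simp]: "sets P = sets m" "sets Q = sets m" by (simp_all add: P_def Q_def)
  have I: "finite I" unfolding I_def by (rule finite_range_cell)
  have XY [measurable]: "X c \<in> sets m" "Y c \<in> sets m" for c
    using measurable_cell[of F m k c] measurable_cell[of G m k c] FG
    by (simp_all add: X_def Y_def space_eq_UNIV)
  have KLm [measurable]: "K \<in> sets m" "L \<in> sets m"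
    using KL by (simp_all add: sets_eq_borel borel_closed compact_imp_closed)
  then have KLc [measurable]: "- K \<in> sets m" "- L \<in> sets m"
    by (simp_all add: sets_eq_borel borel_comp)
  have UNIVm [measurable]: "UNIV \<in> sets m" by (simp add: sets_eq_borel)
  let ?r = "\<lambda>S T. \<lambda>(x, y). indicator S x * indicator T y * w (x, y)"
  have cell_bound: "T_norm m (?r (X c) (Y c)) \<le>
      ennreal (1 / e) * emeasure P (- K \<inter> X c) + ennreal e * emeasure Q (UNIV \<inter> Y c)
      + (ennreal e * emeasure P (UNIV \<inter> X c) + ennreal (1 / e) * emeasure Q (- L \<inter> Y c))
      + ennreal d * (2 * emeasure m (K \<inter> X c) + emeasure m (L \<inter> Y c) + emeasure Q (UNIV \<inter> Y c))"
    (is "_ \<le> ?B1 + ?B2 + ?B3") for c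
  proof -
    have eq: "?r (X c) (Y c) = (\<lambda>p. ?r (- K \<inter> X c) (UNIV \<inter> Y c) p + ?r (K \<inter> X c) (- L \<inter> Y c) p
        + ?r (K \<inter> X c) (L \<inter> Y c) p)"
      by (auto simp: fun_eq_iff indicator_def)
    have "T_norm m (?r (X c) (Y c)) \<le> T_norm m (?r (- K \<inter> X c) (UNIV \<inter> Y c))
        + T_norm m (?r (K \<inter> X c) (- L \<inter> Y c)) + T_norm m (?r (K \<inter> X c) (L \<inter> Y c))"
      unfolding eq by (intro order_trans[OF T_norm_add] add_mono T_norm_add order_refl)
    moreover have "T_norm m (?r (- K \<inter> X c) (UNIV \<inter> Y c)) \<le> ?B1"
      unfolding P_def Q_def
      by (intro T_norm_rectangle_le[OF meas fin w _ _ \<open>0 < e\<close>] sets.Int XY KLc UNIVm)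
    moreover have "T_norm m (?r (K \<inter> X c) (- L \<inter> Y c)) \<le> ?B2"
    proof -
      have "T_norm m (?r (K \<inter> X c) (- L \<inter> Y c)) \<le>
          ennreal (1 / (1 / e)) * emeasure P (K \<inter> X c) + ennreal (1 / e) * emeasure Q (- L \<inter> Y c)"
        unfolding P_def Q_def
        by (rule T_norm_rectangle_le[OF meas fin w]) (use \<open>0 < e\<close> in \<open>auto intro!: sets.Int XY KLm KLc\<close>)
      also have "\<dots> \<le> ?B2"
        using XY by (intro add_mono mult_mono emeasure_mono) auto
      finally show ?thesis .
    qed
    moreover have "T_norm m (?r (K \<inter> X c) (L \<inter> Y c)) \<le> ?B3"
    proof -
      have small: "emeasure m (K \<inter> X c) < \<infinity>" "emeasure m (L \<inter> Y c) < \<infinity>"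
        using compact_finite[OF KL(1)] compact_finite[OF KL(2)]
          emeasure_mono[of "K \<inter> X c" K m] emeasure_mono[of "L \<inter> Y c" L m] KLm
        by (auto intro: le_less_trans)
      have "negligible_rectangle a b d (K \<inter> X c) (L \<inter> Y c)"
        using neg[of c] by (simp add: X_def Y_def Int_def)
      then have "T_norm m (?r (K \<inter> X c) (L \<inter> Y c)) \<le>
          ennreal d * (2 * emeasure m (K \<inter> X c) + emeasure m (L \<inter> Y c) + emeasure Q (L \<inter> Y c))"
        unfolding Q_def
        by (intro T_norm_negligible_rectangle[OF meas fin(2) a b w _ _ small _ \<open>0 < d\<close>] sets.Int XY KLm)
      also have "\<dots> \<le> ?B3"
        using XY by (intro mult_left_mono add_mono emeasure_mono) auto
      finally show ?thesis .
    qed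
    ultimately show ?thesis
      by (meson add_mono order_trans)
  qed
  have sum_eq: "(\<lambda>(x, y). if cell k F x = cell k G y then w (x, y) else 0) = (\<lambda>p. \<Sum>c\<in>I. ?r (X c) (Y c) p)"
  proof -
    have "(if cell k F x = cell k G y then w (x, y) else 0)
        = (\<Sum>c\<in>I. indicator (X c) x * indicator (Y c) y * w (x, y))" for x y
    proof -
      have "(\<Sum>c\<in>I. indicator (X c) x * indicator (Y c) y * w (x, y))
          = (\<Sum>c\<in>I. if c = cell k F x then indicator (Y c) y * w (x, y) else 0)"
        by (intro sum.cong) (auto simp: X_def)
      also have "\<dots> = indicator (Y (cell k F x)) y * w (x, y)"
        using I by (simp add: I_def)
      finally show ?thesis
        by (auto simp: Y_def indicator_def)
    qed
    then show ?thesis by (auto simp: fun_eq_iff)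
  qed
  have disj: "disjoint_family_on X I" "disjoint_family_on Y I"
    by (auto simp: disjoint_family_on_def X_def Y_def)
  have X_sum: "(\<Sum>c\<in>I. emeasure M (T \<inter> X c)) = emeasure M T" if "sets M = sets m" "T \<in> sets m" for M T
  proof (rule sum_emeasure_partition[OF I _ _ _ disj(1)])
    show "T \<subseteq> (\<Union>c\<in>I. X c)" by (auto simp: I_def X_def)
  qed (use that XY in simp_all)
  have Y_sum: "(\<Sum>c\<in>I. emeasure M (T \<inter> Y c)) \<le> emeasure M T" if "sets M = sets m" "T \<in> sets m" for M T
  proof -
    have "(\<Sum>c\<in>I. emeasure M (T \<inter> Y c)) = emeasure M (\<Union>c\<in>I. T \<inter> Y c)"
      using I XY that by (intro sum_emeasure) (auto simp: disjoint_family_on_def Y_def space_eq_UNIV)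
    also have "\<dots> \<le> emeasure M T"
      using that by (intro emeasure_mono) auto
    finally show ?thesis .
  qed
  have "T_norm m (\<lambda>(x, y). if cell k F x = cell k G y then w (x, y) else 0) \<le> (\<Sum>c\<in>I. T_norm m (?r (X c) (Y c)))"
    unfolding sum_eq by (rule T_norm_sum[OF I])
  also have "\<dots> \<le> (\<Sum>c\<in>I. ennreal (1 / e) * emeasure P (- K \<inter> X c) + ennreal e * emeasure Q (UNIV \<inter> Y c)
      + (ennreal e * emeasure P (UNIV \<inter> X c) + ennreal (1 / e) * emeasure Q (- L \<inter> Y c))
      + ennreal d * (2 * emeasure m (K \<inter> X c) + emeasure m (L \<inter> Y c) + emeasure Q (UNIV \<inter> Y c)))"
    by (intro sum_mono cell_bound)
  also have "\<dots> = ennreal (1 / e) * (\<Sum>c\<in>I. emeasure P (- K \<inter> X c)) + ennreal e * (\<Sum>c\<in>I. emeasure Q (UNIV \<inter> Y c))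
      + (ennreal e * (\<Sum>c\<in>I. emeasure P (UNIV \<inter> X c)) + ennreal (1 / e) * (\<Sum>c\<in>I. emeasure Q (- L \<inter> Y c)))
      + ennreal d * (2 * (\<Sum>c\<in>I. emeasure m (K \<inter> X c)) + (\<Sum>c\<in>I. emeasure m (L \<inter> Y c)) + (\<Sum>c\<in>I. emeasure Q (UNIV \<inter> Y c)))"
    by (simp only: sum.distrib sum_distrib_left[symmetric])
  also have "\<dots> \<le> ennreal (1 / e) * emeasure P (- K) + ennreal e * emeasure Q UNIV
      + (ennreal e * emeasure P UNIV + ennreal (1 / e) * emeasure Q (- L))
      + ennreal d * (2 * emeasure m K + emeasure m L + emeasure Q UNIV)"
    by (intro add_mono mult_left_mono eq_refl[OF X_sum] Y_sum sets_PQ refl KLm KLc UNIVm zero_le)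
  finally show ?thesis
    unfolding P_def Q_def .
qed

text \<open>
  Given \<open>e\<close>, the compact sets are chosen first, and only then \<open>d\<close>, since the bound for the negligible
  part involves the measures of \<open>K\<close> and \<open>L\<close>.
\<close>

proposition T_norm_cells_tendsto_0:
  fixes F G :: "nat \<Rightarrow> 'a set"
  assumes FG: "\<And>i. F i \<in> sets m" "\<And>i. G i \<in> sets m"
    and w: "w \<in> Phi_space m {(s, t). \<forall>i. s \<in> F i \<longleftrightarrow> t \<in> G i}"
  shows "(\<lambda>k. T_norm m (\<lambda>(x, y). if cell k F x = cell k G y then w (x, y) else 0)) \<longlonglongrightarrow> 0"
proof -
  obtain a b :: "nat \<Rightarrow> 'a \<Rightarrow> complex"
    where meas: "\<And>n. a n \<in> borel_measurable m" "\<And>n. b n \<in> borel_measurable m"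
      and fin: "(\<integral>\<^sup>+x. rho a x \<partial>m) < \<infinity>" "(\<integral>\<^sup>+y. rho b y \<partial>m) < \<infinity>"
      and rho_fin: "\<And>x. x \<in> space m \<Longrightarrow> rho a x < \<infinity>" "\<And>y. y \<in> space m \<Longrightarrow> rho b y < \<infinity>"
      and sums: "mae m (\<lambda>(x, y). (\<lambda>n. a n x * b n y) sums w (x, y))"
      and zero: "\<And>x y. (x, y) \<in> {(s, t). \<forall>i. s \<in> F i \<longleftrightarrow> t \<in> G i} \<Longrightarrow> x \<in> space m \<Longrightarrow> y \<in> space m
        \<Longrightarrow> (\<lambda>n. a n x * b n y) sums 0"
    by (rule Phi_space_square_summable[OF w]) blast
  have a: "summable (\<lambda>n. (cmod (a n x))\<^sup>2)" and b: "summable (\<lambda>n. (cmod (b n x))\<^sup>2)" for x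
  proof -
    have "rho a x \<noteq> top" "rho b x \<noteq> top"
      using rho_fin[of x] by (simp_all add: space_eq_UNIV)
    note top = this[unfolded rho_def]
    show "summable (\<lambda>n. (cmod (a n x))\<^sup>2)"
      by (rule summable_suminf_not_top[OF zero_le_power2 top(1)])
    show "summable (\<lambda>n. (cmod (b n x))\<^sup>2)"
      by (rule summable_suminf_not_top[OF zero_le_power2 top(2)])
  qed
  have zero': "(\<Sum>n. a n x * b n y) = 0" if "\<And>i. x \<in> F i \<longleftrightarrow> y \<in> G i" for x y
    using zero[of x y] that by (simp add: sums_iff space_eq_UNIV)
  have dens: "sets (density m (rho c)) = sets m" "finite_measure (density m (rho c))"
      "absolutely_continuous m (density m (rho c))" "emeasure (density m (rho c)) UNIV < \<infinity>"
    if [measurable]: "\<And>n. c n \<in> borel_measurable m" and f: "(\<integral>\<^sup>+x. rho c x \<partial>m) < \<infinity>" for c :: "nat \<Rightarrow> 'a \<Rightarrow> complex"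
  proof -
    have "emeasure (density m (rho c)) UNIV = (\<integral>\<^sup>+x. rho c x \<partial>m)"
      by (subst emeasure_density) (simp_all add: sets_eq_borel)
    then show "emeasure (density m (rho c)) UNIV < \<infinity>" using f by simp
    then show "finite_measure (density m (rho c))"
      by (intro finite_measureI) (simp add: space_eq_UNIV)
    show "absolutely_continuous m (density m (rho c))"
      by (rule absolutely_continuousI_density) simp
  qed simp
  note P = dens[OF meas(1) fin(1)] and Q = dens[OF meas(2) fin(2)]
  \<comment> \<open>the functions that are to become continuous on the compact sets\<close>
  define H where "H F a = range (\<lambda>i. indicator (F i)) \<union> range a
      \<union> range (\<lambda>N x. complex_of_real (\<Sum>n. (cmod (a (n + N) x))\<^sup>2))"
    for F :: "nat \<Rightarrow> 'a set" and a :: "nat \<Rightarrow> 'a \<Rightarrow> complex"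
  have H_count: "countable (H F a)" for F a
    unfolding H_def by simp
  have H_meas: "h \<in> borel_measurable m"
    if [measurable]: "\<And>i. F i \<in> sets m" "\<And>n. a n \<in> borel_measurable m" and h: "h \<in> H F a" for F a h
    using h unfolding H_def by (elim UnE imageE) simp_all
  have H_cont: "continuous_on S (indicator (F i) :: 'a \<Rightarrow> complex)" "continuous_on S (a n)"
      "continuous_on S (\<lambda>x. \<Sum>n. (cmod (a (n + N) x))\<^sup>2)"
    if "\<And>h. h \<in> H F a \<Longrightarrow> continuous_on S h" for S F a i n N
  proof -
    show "continuous_on S (indicator (F i) :: 'a \<Rightarrow> complex)" "continuous_on S (a n)"
      by (rule that; simp add: H_def)+
    have "continuous_on S (\<lambda>x. complex_of_real (\<Sum>n. (cmod (a (n + N) x))\<^sup>2))"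
      by (rule that) (simp add: H_def)
    from continuous_on_Re[OF this] show "continuous_on S (\<lambda>x. \<Sum>n. (cmod (a (n + N) x))\<^sup>2)"
      by simp
  qed
  have H_meas_a: "h \<in> borel_measurable m" if "h \<in> H F a" for h
    by (rule H_meas[OF FG(1) meas(1) that])
  have H_meas_b: "h \<in> borel_measurable m" if "h \<in> H G b" for h
    by (rule H_meas[OF FG(2) meas(2) that])
  have small: "\<exists>k0. \<forall>k\<ge>k0. T_norm m (\<lambda>(x, y). if cell k F x = cell k G y then w (x, y) else 0) \<le> ennreal \<epsilon>"
    if "0 < \<epsilon>" for \<epsilon> :: real
  proof -
    let ?P = "emeasure (density m (rho a))" and ?Q = "emeasure (density m (rho b))"
    have "?P UNIV + ?Q UNIV + 3 < \<infinity>"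
      using P(4) Q(4) by simp
    from ennreal_scale_below[OF this \<open>0 < \<epsilon>\<close>] obtain e where e: "0 < e"
        "ennreal e * (?P UNIV + ?Q UNIV + 3) \<le> ennreal \<epsilon>" .
    have "0 < e\<^sup>2" using e by simp
    have "\<exists>K. compact K \<and> ?P (- K) \<le> ennreal (e\<^sup>2) \<and> (\<forall>h\<in>H F a. continuous_on K h)"
    proof (rule lusin_functions[OF P(1-3) H_count H_meas_a \<open>0 < e\<^sup>2\<close>])
      fix S assume S: "compact S" "?P (- S) \<le> ennreal (e\<^sup>2)" "\<And>h. h \<in> H F a \<Longrightarrow> continuous_on S h"
      show ?thesis by (rule exI[of _ S]) (simp add: S)
    qed
    then obtain K where K: "compact K" "?P (- K) \<le> ennreal (e\<^sup>2)" "\<And>h. h \<in> H F a \<Longrightarrow> continuous_on K h"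
      by blast
    have "\<exists>L. compact L \<and> ?Q (- L) \<le> ennreal (e\<^sup>2) \<and> (\<forall>h\<in>H G b. continuous_on L h)"
    proof (rule lusin_functions[OF Q(1-3) H_count H_meas_b \<open>0 < e\<^sup>2\<close>])
      fix S assume S: "compact S" "?Q (- S) \<le> ennreal (e\<^sup>2)" "\<And>h. h \<in> H G b \<Longrightarrow> continuous_on S h"
      show ?thesis by (rule exI[of _ S]) (simp add: S)
    qed
    then obtain L where L: "compact L" "?Q (- L) \<le> ennreal (e\<^sup>2)" "\<And>h. h \<in> H G b \<Longrightarrow> continuous_on L h"
      by blast
    have "2 * emeasure m K + emeasure m L + ?Q UNIV < \<infinity>"
      using compact_finite[OF K(1)] compact_finite[OF L(1)] Q(4) by (simp add: ennreal_mult_less_top)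
    from ennreal_scale_below[OF this e(1)] obtain d where d: "0 < d"
        "ennreal d * (2 * emeasure m K + emeasure m L + ?Q UNIV) \<le> ennreal e" .
    note contK = H_cont[of F a K, OF K(3)] and contL = H_cont[of G b L, OF L(3)]
    have "\<exists>k0. \<forall>k\<ge>k0. \<forall>c. negligible_rectangle a b d {x \<in> K. cell k F x = c} {y \<in> L. cell k G y = c}"
    proof (rule negligible_cells[OF a b K(1) L(1) contK(2,3) contL(2,3) contK(1) contL(1) zero' d(1)])
      fix k0 assume "\<And>k c. k0 \<le> k \<Longrightarrow>
        negligible_rectangle a b d {x \<in> K. cell k F x = c} {y \<in> L. cell k G y = c}"
      then show ?thesis by blast
    qed
    then obtain k0 where k0: "\<And>k c. k0 \<le> k \<Longrightarrow>
        negligible_rectangle a b d {x \<in> K. cell k F x = c} {y \<in> L. cell k G y = c}" by blast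
    have e2: "ennreal (1 / e) * ennreal (e\<^sup>2) = ennreal e"
      using e(1) by (simp add: power2_eq_square flip: ennreal_mult)
    have e3: "ennreal e * 3 = ennreal e + ennreal e + ennreal e"
      using e(1) by (simp flip: ennreal_plus ennreal_numeral ennreal_mult')
    have "T_norm m (\<lambda>(x, y). if cell k F x = cell k G y then w (x, y) else 0) \<le> ennreal \<epsilon>" if "k0 \<le> k" for k
    proof -
      have "T_norm m (\<lambda>(x, y). if cell k F x = cell k G y then w (x, y) else 0)
          \<le> ennreal (1 / e) * ?P (- K) + ennreal e * ?Q UNIV
            + (ennreal e * ?P UNIV + ennreal (1 / e) * ?Q (- L))
            + ennreal d * (2 * emeasure m K + emeasure m L + ?Q UNIV)"
        by (rule T_norm_cells_le[OF meas fin a b sums FG K(1) L(1) k0[OF that] d(1) e(1)])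
      also have "\<dots> \<le> ennreal (1 / e) * ennreal (e\<^sup>2) + ennreal e * ?Q UNIV
            + (ennreal e * ?P UNIV + ennreal (1 / e) * ennreal (e\<^sup>2)) + ennreal e"
        by (intro add_mono mult_left_mono K(2) L(2) d(2) order_refl zero_le)
      also have "\<dots> = ennreal e * (?P UNIV + ?Q UNIV + 3)"
        unfolding e2 distrib_left e3 by (simp only: ac_simps)
      also have "\<dots> \<le> ennreal \<epsilon>" by (rule e(2))
      finally show ?thesis .
    qed
    then show ?thesis by blast
  qed
  show ?thesis
  proof (rule order_tendstoI)
    fix \<delta> :: ennreal assume "0 < \<delta>"
    then obtain \<epsilon> where \<epsilon>: "0 < ennreal \<epsilon>" "ennreal \<epsilon> < \<delta>"
      by (metis dense ennreal_cases less_top_ennreal order.strict_trans2 top_greatest)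
    then obtain k0 where "\<forall>k\<ge>k0. T_norm m (\<lambda>(x, y). if cell k F x = cell k G y then w (x, y) else 0) \<le> ennreal \<epsilon>"
      using small[of \<epsilon>] by auto
    then show "\<forall>\<^sub>F k in sequentially. T_norm m (\<lambda>(x, y). if cell k F x = cell k G y then w (x, y) else 0) < \<delta>"
      using \<epsilon>(2) unfolding eventually_sequentially by (meson le_less_trans)
  qed simp
qed

end

section \<open>The strong Ditkin property\<close>

lemma pseudo_open_UN:
  assumes "\<And>n. A n \<in> sets m" "\<And>n. B n \<in> sets m"
  shows "pseudo_open m (\<Union>n::nat. A n \<times> B n)"
proof -
  have "(\<Union>n. A n \<times> B n) \<subseteq> space m \<times> space m"
    using assms[THEN sets.sets_into_space] by blast
  moreover have "marginally_equivalent m (\<Union>n. A n \<times> B n) (\<Union>n. A n \<times> B n)"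
    by (simp add: marginally_equivalent_def)
  ultimately show ?thesis
    unfolding pseudo_open_def using assms by blast
qed

lemma pseudo_closed_agreement:
  assumes "\<And>i. F i \<in> sets m" "\<And>i. G i \<in> sets m"
  shows "pseudo_closed m {(s, t) \<in> space m \<times> space m. \<forall>i::nat. s \<in> F i \<longleftrightarrow> t \<in> G i}"
proof -
  define A where "A n = (if even n then F (n div 2) else space m - F (n div 2))" for n
  define B where "B n = (if even n then space m - G (n div 2) else G (n div 2))" for n
  have "space m \<times> space m - {(s, t) \<in> space m \<times> space m. \<forall>i. s \<in> F i \<longleftrightarrow> t \<in> G i} = (\<Union>n. A n \<times> B n)"
  proof (intro equalityI subsetI)
    fix p assume p: "p \<in> space m \<times> space m - {(s, t) \<in> space m \<times> space m. \<forall>i. s \<in> F i \<longleftrightarrow> t \<in> G i}"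
    obtain s t where st: "p = (s, t)" by (cases p)
    with p obtain i where i: "s \<in> space m" "t \<in> space m" "(s \<in> F i) \<noteq> (t \<in> G i)" by auto
    then have "p \<in> A (2 * i) \<times> B (2 * i) \<or> p \<in> A (2 * i + 1) \<times> B (2 * i + 1)"
      unfolding st A_def B_def by auto
    then show "p \<in> (\<Union>n. A n \<times> B n)" by blast
  next
    fix p assume "p \<in> (\<Union>n. A n \<times> B n)"
    then show "p \<in> space m \<times> space m - {(s, t) \<in> space m \<times> space m. \<forall>i. s \<in> F i \<longleftrightarrow> t \<in> G i}"
      using assms[THEN sets.sets_into_space] by (auto simp: A_def B_def split: if_splits)
  qed
  moreover have "pseudo_open m (\<Union>n. A n \<times> B n)"
    by (rule pseudo_open_UN) (use assms in \<open>auto simp: A_def B_def\<close>)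
  ultimately show ?thesis
    unfolding pseudo_closed_def by auto
qed

text \<open>
  The cut-off \<open>1 - \<Sum>\<^sub>c \<chi>(X\<^sub>c) \<otimes> \<chi>(Y\<^sub>c)\<close>, with \<open>X\<^sub>c\<close> and \<open>Y\<^sub>c\<close> the level-\<open>k\<close> cells with code \<open>c\<close>. The
  cells are disjoint, so the square sums of the coefficients are at most \<open>1 + 1\<close>.
\<close>

lemma cell_cutoff_in_V_infty:
  assumes FG: "\<And>i. F i \<in> sets m" "\<And>i. G i \<in> sets m"
  shows "(\<lambda>(x, y). if cell k F x = cell k G y then 0 else 1) \<in> V_infty m"
proof -
  define a :: "nat \<Rightarrow> 'a \<Rightarrow> complex"
    where "a n x = (case n of 0 \<Rightarrow> 1 | Suc c \<Rightarrow> if cell k F x = c then - 1 else 0)" for n x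
  define b :: "nat \<Rightarrow> 'a \<Rightarrow> complex"
    where "b n y = (case n of 0 \<Rightarrow> 1 | Suc c \<Rightarrow> if cell k G y = c then 1 else 0)" for n y
  have [measurable]: "Measurable.pred m (\<lambda>x. cell k F x = c)" "Measurable.pred m (\<lambda>x. cell k G x = c)" for c
    using measurable_cell[of F m k c, OF FG(1)] measurable_cell[of G m k c, OF FG(2)] by (simp_all add: pred_def)
  have a_zero: "a n x = 0" if "n \<notin> {0, Suc (cell k F x)}" for n x
    using that by (auto simp: a_def split: nat.split)
  have b_zero: "b n x = 0" if "n \<notin> {0, Suc (cell k G x)}" for n x
    using that by (auto simp: b_def split: nat.split)
  have sq_a: "(\<lambda>n. (cmod (a n x))\<^sup>2) sums 2" for x
  proof -
    have "(\<lambda>n. (cmod (a n x))\<^sup>2) sums (\<Sum>n\<in>{0, Suc (cell k F x)}. (cmod (a n x))\<^sup>2)"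
      by (rule sums_finite) (use a_zero in auto)
    then show ?thesis by (simp add: a_def)
  qed
  have sq_b: "(\<lambda>n. (cmod (b n x))\<^sup>2) sums 2" for x
  proof -
    have "(\<lambda>n. (cmod (b n x))\<^sup>2) sums (\<Sum>n\<in>{0, Suc (cell k G x)}. (cmod (b n x))\<^sup>2)"
      by (rule sums_finite) (use b_zero in auto)
    then show ?thesis by (simp add: b_def)
  qed
  have prod: "(\<lambda>n. a n x * b n y) sums (if cell k F x = cell k G y then 0 else 1)" for x y
  proof -
    have "(\<lambda>n. a n x * b n y) sums (\<Sum>n\<in>{0, Suc (cell k F x)}. a n x * b n y)"
      by (rule sums_finite) (use a_zero in auto)
    then show ?thesis by (simp add: a_def b_def eq_commute split: if_splits)
  qed
  have bound: "cmod (a n x) \<le> 1" "cmod (b n x) \<le> 1" for n x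
    by (simp_all add: a_def b_def split: nat.split)
  have a_meas: "a n \<in> borel_measurable m" for n
    unfolding a_def by (cases n) simp_all
  have b_meas: "b n \<in> borel_measurable m" for n
    unfolding b_def by (cases n) simp_all
  show ?thesis
    unfolding V_infty_def
  proof (intro CollectI exI conjI allI)
    show "in_Linfty m (a n)" "in_Linfty m (b n)" for n
      using a_meas b_meas bound by (auto simp: in_Linfty_def intro!: exI[of _ 1])
    show "AE x in m. summable (\<lambda>n. (cmod (a n x))\<^sup>2) \<and> (\<Sum>n. (cmod (a n x))\<^sup>2) \<le> 2"
      "AE y in m. summable (\<lambda>n. (cmod (b n y))\<^sup>2) \<and> (\<Sum>n. (cmod (b n y))\<^sup>2) \<le> 2"
      using sq_a sq_b by (simp_all add: sums_iff)
    show "mae m (\<lambda>(x, y). (\<lambda>n. a n x * b n y) sums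
        (case (x, y) of (x, y) \<Rightarrow> if cell k F x = cell k G y then 0 else 1))"
      by (rule mae_everywhere) (use prod in simp)
  qed
qed

text \<open>The cut-off vanishes on a countable union of rectangles that contains the set.\<close>

lemma cell_cutoff_vanishes_near:
  assumes FG: "\<And>i. F i \<in> sets m" "\<And>i. G i \<in> sets m" and sp: "space m = UNIV"
  shows "vanishes_near m {(s, t). \<forall>i. s \<in> F i \<longleftrightarrow> t \<in> G i}
    (\<lambda>(x, y). if cell k F x = cell k G y then 0 else 1)"
proof -
  let ?U = "\<Union>c. {x \<in> space m. cell k F x = c} \<times> {y \<in> space m. cell k G y = c}"
  have "pseudo_open m ?U"
    by (intro pseudo_open_UN measurable_cell FG)
  moreover have "marginally_null m ({(s, t). \<forall>i. s \<in> F i \<longleftrightarrow> t \<in> G i} - ?U)"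
  proof -
    have "(s, t) \<in> ?U" if "\<forall>i. s \<in> F i \<longleftrightarrow> t \<in> G i" for s t
    proof (rule UN_I[of "cell k F s"])
      have "cell k G t = cell k F s" using that by (simp add: cell_eq_iff)
      then show "(s, t) \<in> {x \<in> space m. cell k F x = cell k F s} \<times> {y \<in> space m. cell k G y = cell k F s}"
        by (simp add: sp)
    qed simp
    then show ?thesis
      by (intro marginally_null_mono[OF marginally_null_empty]) blast
  qed
  moreover have "mae m (\<lambda>p. p \<in> ?U \<longrightarrow> (\<lambda>(x, y). if cell k F x = cell k G y then 0 else 1 :: complex) p = 0)"
    by (rule mae_everywhere) auto
  ultimately show ?thesis
    unfolding vanishes_near_def pseudo_neighbourhood_def by (intro exI[of _ ?U] conjI)
qed

text \<open>
  Multiplying \<open>w\<close> by the cut-off and subtracting \<open>w\<close> leaves \<open>- w\<close> truncated to the cells of level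
  \<open>k\<close>, to which the convergence result applies.
\<close>

proposition (in outer_regular_measure) strong_m_Ditkin_agreement:
  assumes FG: "\<And>i. F i \<in> sets m" "\<And>i. G i \<in> sets m"
  shows "strong_m_Ditkin m {(s, t). \<forall>i::nat. s \<in> F i \<longleftrightarrow> t \<in> G i}"
  unfolding strong_m_Ditkin_def
proof (intro conjI exI[of _ "\<lambda>k (x, y). if cell k F x = cell k G y then 0 else 1"] allI ballI)
  show "pseudo_closed m {(s, t). \<forall>i. s \<in> F i \<longleftrightarrow> t \<in> G i}"
    using pseudo_closed_agreement[of F m G, OF FG] by (simp add: space_eq_UNIV)
  show "(\<lambda>(x, y). if cell k F x = cell k G y then 0 else 1) \<in> V_infty m" for k
    using FG by (rule cell_cutoff_in_V_infty)
  show "vanishes_near m {(s, t). \<forall>i. s \<in> F i \<longleftrightarrow> t \<in> G i} (\<lambda>(x, y). if cell k F x = cell k G y then 0 else 1)" for k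
    using FG space_eq_UNIV by (rule cell_cutoff_vanishes_near)
  fix w assume w: "w \<in> Phi_space m {(s, t). \<forall>i. s \<in> F i \<longleftrightarrow> t \<in> G i}"
  have "(\<lambda>p. - w p) \<in> Phi_space m {(s, t). \<forall>i. s \<in> F i \<longleftrightarrow> t \<in> G i}"
  proof -
    obtain f g where rep: "T_representation m w f g"
      and van: "mae m (\<lambda>p. p \<in> {(s, t). \<forall>i. s \<in> F i \<longleftrightarrow> t \<in> G i} \<longrightarrow> w p = 0)"
      using w unfolding Phi_space_def T_space_def by blast
    have "mae m (\<lambda>(x, y). (\<lambda>n. - f n x * g n y) sums - w (x, y))"
      by (rule mae_mono[of m "\<lambda>(x, y). (\<lambda>n. f n x * g n y) sums w (x, y)"])
         (use rep sums_minus in \<open>auto simp: T_representation_def\<close>)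
    then have "T_representation m (\<lambda>p. - w p) (\<lambda>n x. - f n x) g"
      using rep by (simp add: T_representation_def in_L2_def L2_nrm_def)
    with van show ?thesis
      unfolding Phi_space_def T_space_def by auto
  qed
  from T_norm_cells_tendsto_0[OF FG this]
  show "(\<lambda>k. T_norm m (\<lambda>p. (case p of (x, y) \<Rightarrow> if cell k F x = cell k G y then 0 else 1) * w p - w p)) \<longlonglongrightarrow> 0"
    by (rule back_subst[where P = "\<lambda>h. h \<longlonglongrightarrow> 0"])
       (auto intro!: ext arg_cong[of _ _ "T_norm m"])
qed

text \<open>A countable base of a Polish topology separates points, and its members are Borel.\<close>

lemma standard_borel_space_separating:
  assumes "standard_borel_space Z"
  shows "\<exists>S :: nat \<Rightarrow> 'z set. (\<forall>i. S i \<in> sets Z) \<and>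
    (\<forall>x\<in>space Z. \<forall>y\<in>space Z. (\<forall>i. x \<in> S i \<longleftrightarrow> y \<in> S i) \<longrightarrow> x = y)"
proof -
  obtain X where X: "completely_metrizable_space X" "second_countable X"
      "space Z = topspace X" "sets Z = sigma_sets (topspace X) {U. openin X U}"
    using assms unfolding standard_borel_space_def by blast
  obtain \<B> where base: "countable \<B> \<and> (\<forall>V \<in> \<B>. openin X V) \<and>
      (\<forall>U x. openin X U \<and> x \<in> U \<longrightarrow> (\<exists>V \<in> \<B>. x \<in> V \<and> V \<subseteq> U))"
    using X(2) unfolding second_countable_def ..
  then have B: "countable \<B>" "\<And>V. V \<in> \<B> \<Longrightarrow> openin X V" by simp_all
  have nbhd: "\<exists>V\<in>\<B>. x \<in> V \<and> V \<subseteq> U" if "openin X U" "x \<in> U" for U x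
    using base that by simp
  have t0: "t1_space X"
    using X(1) by (intro metrizable_imp_t1_space completely_metrizable_imp_metrizable_space)
  \<comment> \<open>the empty set is inserted because \<open>\<B>\<close> may be empty\<close>
  define S where "S = from_nat_into (insert {} \<B>)"
  have range_S: "range S = insert {} \<B>"
    unfolding S_def using B(1) by (intro range_from_nat_into) auto
  show ?thesis
  proof (intro exI[of _ S] conjI allI ballI impI)
    fix i
    have "S i \<in> insert {} \<B>" using range_S by blast
    then have "openin X (S i)" using B(2) by auto
    then show "S i \<in> sets Z" unfolding X(4) by (intro sigma_sets.Basic) simp
  next
    fix x y assume xy: "x \<in> space Z" "y \<in> space Z" and same: "\<forall>i. x \<in> S i \<longleftrightarrow> y \<in> S i"
    show "x = y"
    proof (rule ccontr)
      assume "x \<noteq> y"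
      then obtain U where U: "openin X U" "x \<in> U" "y \<notin> U"
        using t0 xy unfolding t1_space_def X(3) by blast
      then obtain V where V: "V \<in> \<B>" "x \<in> V" "V \<subseteq> U" using nbhd[OF U(1,2)] by blast
      then obtain i where "S i = V" using range_S by (metis insertI2 rangeE)
      with same V U show False by blast
    qed
  qed
qed

theorem proposition5p1:
  fixes m :: "'a::{topological_group_add, t2_space, second_countable_topology} measure"
    and Z :: "'z measure"
    and f g :: "'a \<Rightarrow> 'z"
  assumes "locally compact (UNIV :: 'a set)"
    and "left_haar_measure m"
    and "standard_borel_space Z"
    and "f \<in> borel \<rightarrow>\<^sub>M Z"
    and "g \<in> borel \<rightarrow>\<^sub>M Z"
  shows "strong_m_Ditkin m {(s, t). f s = g t}"
proof -
  interpret outer_regular_measure m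
  proof
    show "sets m = sets borel" "locally compact (UNIV :: 'a set)"
      using assms(1,2) by (simp_all add: left_haar_measure_def)
    show "emeasure m K < \<infinity>" if "compact K" for K
      using assms(2) that by (simp add: left_haar_measure_def)
    show "emeasure m A = (INF U\<in>{U. open U \<and> A \<subseteq> U}. emeasure m U)" if "A \<in> sets m" for A
    proof -
      have "\<forall>A\<in>sets m. emeasure m A = (INF U\<in>{U. open U \<and> A \<subseteq> U}. emeasure m U)"
        using assms(2) unfolding left_haar_measure_def by (elim conjE)
      then show ?thesis using that by (rule bspec)
    qed
  qed
  \<comment> \<open>a separating sequence in \<open>Z\<close> turns \<open>f s = g t\<close> into agreement on countably many Borel sets\<close>
  obtain S :: "nat \<Rightarrow> 'z set" where S: "\<And>i. S i \<in> sets Z"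
      "\<forall>x\<in>space Z. \<forall>y\<in>space Z. (\<forall>i. x \<in> S i \<longleftrightarrow> y \<in> S i) \<longrightarrow> x = y"
    using standard_borel_space_separating[OF assms(3)] by auto
  have "f -` S i \<in> sets m" "g -` S i \<in> sets m" for i
    using measurable_sets[OF assms(4) S(1)[of i]] measurable_sets[OF assms(5) S(1)[of i]]
    by (simp_all add: sets_eq_borel)
  then have "strong_m_Ditkin m {(s, t). \<forall>i. s \<in> f -` S i \<longleftrightarrow> t \<in> g -` S i}"
    by (rule strong_m_Ditkin_agreement)
  moreover have "(\<forall>i. s \<in> f -` S i \<longleftrightarrow> t \<in> g -` S i) \<longleftrightarrow> f s = g t" for s t
    using S(2) measurable_space[OF assms(4), of s] measurable_space[OF assms(5), of t] by auto
  ultimately show ?thesis by simp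
qed

end
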